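(* Let $n\ge2$ and let $M$ be an $n$-dimensional Riemannian submanifold of $\mathbb E^{n+2}_1$ lying on $\mathcal{LC}^n\times\mathbb R$ for which the function $\alpha$ of the context vanishes at no point. Then $M$ has flat normal bundle if and only if every $p\in M$ has a neighborhood in $M$ which can be parametrized by $$\phi(s,t)=(\hat\alpha(s)\gamma_1(t),\hat\alpha(s)\gamma_2(t),\dots,\hat\alpha(s)\gamma_{n+1}(t),s),\qquad t=(t_2,\dots,t_n),$$ for a smooth non-vanishing function $\hat\alpha$, where $\gamma=(\gamma_1,\gamma_2,\dots,\gamma_{n+1})$ is the position vector of a space-like submanifold $\hat M^{n-1}$ lying on $\mathcal{LC}^n\subset\mathbb E^{n+1}_1$.
   Context: $\mathbb E^{m}_1$ is $\mathbb R^m$ with the metric $\langle\cdot,\cdot\rangle=-dx_1^2+\sum_{i=2}^m dx_i^2$. The (future) light cone is $\mathcal{LC}^n=\{x\in\mathbb E^{n+1}_1:\langle x,x\rangle=0,\ x_1>0\}$, and $\mathcal{LC}^n\times\mathbb R=\{x\in\mathbb E^{n+2}_1: -x_1^2+x_2^2+\cdots+x_{n+1}^2=0,\ x_1>0\}$. Space-like means that the induced metric is Riemannian. $M$ has flat normal bundle if the curvature tensor $R^\perp$ of its normal connection $\nabla^\perp$ vanishes identically. The function $\alpha$ of $M$: if $\phi=(\phi_1,\dots,\phi_{n+2})$ is the position vector of $M$, then $\theta=(\phi_1,\dots,\phi_{n+1},0)$ is a light-like normal field along $M$, and with $e_1=(\partial_{x_{n+2}})^T$ the tangential part of $\partial_{x_{n+2}}|_M$,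 $\alpha\in C^\infty(M)$ is defined by $\nabla^\perp_{e_1}\theta=\alpha\theta$, equivalently $\partial_{x_{n+2}}|_M=e_1-\alpha\theta$. *)

theory Defs
  imports "HOL-Analysis.Analysis"
begin

section \<open>Smooth maps between open subsets of Euclidean spaces\<close>

abbreviation differential :: "('a::euclidean_space \<Rightarrow> 'b::euclidean_space) \<Rightarrow> 'a \<Rightarrow> 'a \<Rightarrow> 'b" where
  "differential f u \<equiv> frechet_derivative f (at u)"

primrec Ck_on :: "nat \<Rightarrow> 'a::euclidean_space set \<Rightarrow> ('a \<Rightarrow> 'b::euclidean_space) \<Rightarrow> bool" where
  "Ck_on 0 U f \<longleftrightarrow> continuous_on U f"
| "Ck_on (Suc k) U f \<longleftrightarrow>
     (\<forall>u\<in>U. f differentiable (at u)) \<and> (\<forall>v. Ck_on k U (\<lambda>u. differential f u v))"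

text \<open>Only meaningful for open \<open>U\<close>: the derivatives are taken in the whole space.\<close>

definition smooth_on :: "'a::euclidean_space set \<Rightarrow> ('a \<Rightarrow> 'b::euclidean_space) \<Rightarrow> bool" where
  "smooth_on U f \<longleftrightarrow> (\<forall>k. Ck_on k U f)"

section \<open>Abstract smooth manifolds\<close>

text \<open>
  A patch is the inverse of a chart: a homeomorphism \<open>x\<close> from an open subset \<open>U\<close> of a Euclidean
  space onto an open subset of the topological space \<open>T\<close>.
\<close>

definition patch :: "'m topology \<Rightarrow> 'a::euclidean_space set \<Rightarrow> ('a \<Rightarrow> 'm) \<Rightarrow> bool" where
  "patch T U x \<longleftrightarrow> open U \<and> openin T (x ` U) \<and>
     homeomorphic_map (top_of_set U) (subtopology T (x ` U)) x"

definition compatible ::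
    "'a::euclidean_space set \<Rightarrow> ('a \<Rightarrow> 'm) \<Rightarrow> 'b::euclidean_space set \<Rightarrow> ('b \<Rightarrow> 'm) \<Rightarrow> bool" where
  "compatible U x V y \<longleftrightarrow>
     smooth_on {u \<in> U. x u \<in> y ` V} (inv_into V y \<circ> x) \<and>
     smooth_on {v \<in> V. y v \<in> x ` U} (inv_into U x \<circ> y)"

text \<open>The dimension of the manifold is that of the Euclidean space \<open>'a\<close>.\<close>

definition smooth_manifold ::
    "'m topology \<Rightarrow> ('a::euclidean_space set \<times> ('a \<Rightarrow> 'm)) set \<Rightarrow> bool" where
  "smooth_manifold T A \<longleftrightarrow>
     Hausdorff_space T \<and> second_countable T \<and>
     (\<forall>(U, x) \<in> A. patch T U x) \<and>
     (\<Union>(U, x) \<in> A. x ` U) = topspace T \<and>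
     (\<forall>(U, x) \<in> A. \<forall>(V, y) \<in> A. compatible U x V y)"

text \<open>
  Membership in the maximal atlas generated by \<open>A\<close>; the domain may lie in a different Euclidean
  space (of the same dimension) than the one used by \<open>A\<close>.
\<close>

definition parametrization ::
    "'m topology \<Rightarrow> ('a::euclidean_space set \<times> ('a \<Rightarrow> 'm)) set \<Rightarrow>
     'b::euclidean_space set \<Rightarrow> ('b \<Rightarrow> 'm) \<Rightarrow> bool" where
  "parametrization T A V y \<longleftrightarrow> patch T V y \<and> (\<forall>(U, x) \<in> A. compatible U x V y)"

section \<open>Riemannian submanifolds of Minkowski space\<close>

text \<open>
  Minkowski space of dimension \<open>m\<close> is modelled as \<open>real \<times> 'v\<close> with \<open>DIM('v) = m - 1\<close>; the first
  component is the time-like coordinate.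
\<close>

definition lorentz :: "real \<times> 'v::euclidean_space \<Rightarrow> real \<times> 'v \<Rightarrow> real" where
  "lorentz p q = - (fst p * fst q) + snd p \<bullet> snd q"

definition spacelike_immersion ::
    "'a::euclidean_space set \<Rightarrow> ('a \<Rightarrow> real \<times> 'v::euclidean_space) \<Rightarrow> bool" where
  "spacelike_immersion U f \<longleftrightarrow>
     smooth_on U f \<and>
     (\<forall>u\<in>U. inj (differential f u) \<and>
        (\<forall>v. v \<noteq> 0 \<longrightarrow> lorentz (differential f u v) (differential f u v) > 0))"

text \<open>
  Submanifolds are immersed: \<open>\<phi>\<close> is the position vector, a map from the abstract manifold into
  Minkowski space. Subsets that are embedded submanifolds are the case where \<open>T\<close> is the subspace
  topology and \<open>\<phi>\<close> the inclusion.
\<close>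

definition riemannian_submanifold ::
    "'m topology \<Rightarrow> ('a::euclidean_space set \<times> ('a \<Rightarrow> 'm)) set \<Rightarrow>
     ('m \<Rightarrow> real \<times> 'v::euclidean_space) \<Rightarrow> bool" where
  "riemannian_submanifold T A \<phi> \<longleftrightarrow>
     smooth_manifold T A \<and> (\<forall>(U, x) \<in> A. spacelike_immersion U (\<phi> \<circ> x))"

section \<open>Normal connection and normal curvature\<close>

text \<open>
  In this section \<open>f\<close> is the position vector read in a patch, a space-like immersion of an open
  subset of \<open>'a\<close>. A tangent vector field is given by its components \<open>X :: 'a \<Rightarrow> 'a\<close> in the
  patch, so the field along \<open>f\<close> is \<open>\<lambda>u. differential f u (X u)\<close>.
\<close>

definition tangent_space ::
    "('a::euclidean_space \<Rightarrow> real \<times> 'v::euclidean_space) \<Rightarrow> 'a \<Rightarrow> (real \<times> 'v) set" where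
  "tangent_space f u = range (differential f u)"

definition normal_space ::
    "('a::euclidean_space \<Rightarrow> real \<times> 'v::euclidean_space) \<Rightarrow> 'a \<Rightarrow> (real \<times> 'v) set" where
  "normal_space f u = {\<xi>. \<forall>w \<in> tangent_space f u. lorentz \<xi> w = 0}"

text \<open>Well defined because the Lorentz product is positive definite on the tangent space.\<close>

definition tangent_part ::
    "('a::euclidean_space \<Rightarrow> real \<times> 'v::euclidean_space) \<Rightarrow> 'a \<Rightarrow> real \<times> 'v \<Rightarrow> real \<times> 'v" where
  "tangent_part f u w = (THE a. a \<in> tangent_space f u \<and> w - a \<in> normal_space f u)"

definition normal_part ::
    "('a::euclidean_space \<Rightarrow> real \<times> 'v::euclidean_space) \<Rightarrow> 'a \<Rightarrow> real \<times> 'v \<Rightarrow> real \<times> 'v" where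
  "normal_part f u w = w - tangent_part f u w"

definition normal_field ::
    "('a::euclidean_space \<Rightarrow> real \<times> 'v::euclidean_space) \<Rightarrow> 'a set \<Rightarrow> ('a \<Rightarrow> real \<times> 'v) \<Rightarrow> bool" where
  "normal_field f U \<xi> \<longleftrightarrow> smooth_on U \<xi> \<and> (\<forall>u\<in>U. \<xi> u \<in> normal_space f u)"

definition normal_connection ::
    "('a::euclidean_space \<Rightarrow> real \<times> 'v::euclidean_space) \<Rightarrow> ('a \<Rightarrow> 'a) \<Rightarrow>
     ('a \<Rightarrow> real \<times> 'v) \<Rightarrow> ('a \<Rightarrow> real \<times> 'v)" where
  "normal_connection f X \<xi> = (\<lambda>u. normal_part f u (differential \<xi> u (X u)))"

definition lie_bracket :: "('a::euclidean_space \<Rightarrow> 'a) \<Rightarrow> ('a \<Rightarrow> 'a) \<Rightarrow> ('a \<Rightarrow> 'a)" where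
  "lie_bracket X Y = (\<lambda>u. differential Y u (X u) - differential X u (Y u))"

definition normal_curvature ::
    "('a::euclidean_space \<Rightarrow> real \<times> 'v::euclidean_space) \<Rightarrow> ('a \<Rightarrow> 'a) \<Rightarrow> ('a \<Rightarrow> 'a) \<Rightarrow>
     ('a \<Rightarrow> real \<times> 'v) \<Rightarrow> ('a \<Rightarrow> real \<times> 'v)" where
  "normal_curvature f X Y \<xi> = (\<lambda>u.
     normal_connection f X (normal_connection f Y \<xi>) u
     - normal_connection f Y (normal_connection f X \<xi>) u
     - normal_connection f (lie_bracket X Y) \<xi> u)"

definition flat_normal_bundle ::
    "('a::euclidean_space set \<times> ('a \<Rightarrow> 'm)) set \<Rightarrow> ('m \<Rightarrow> real \<times> 'v::euclidean_space) \<Rightarrow> bool" where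
  "flat_normal_bundle A \<phi> \<longleftrightarrow>
     (\<forall>(U, x) \<in> A. \<forall>X Y \<xi>. smooth_on U X \<longrightarrow> smooth_on U Y \<longrightarrow> normal_field (\<phi> \<circ> x) U \<xi> \<longrightarrow>
        (\<forall>u\<in>U. normal_curvature (\<phi> \<circ> x) X Y \<xi> u = 0))"

section \<open>The light cone, the cylinder over it, and the function \<open>\<alpha>\<close>\<close>

definition light_cone :: "(real \<times> 'v::euclidean_space) set" where
  "light_cone = {x. lorentz x x = 0 \<and> fst x > 0}"

text \<open>
  Points of the cylinder are written \<open>(x\<^sub>1, (y, z))\<close> with \<open>y\<close> collecting the coordinates
  \<open>x\<^sub>2, \<dots>, x\<^bsub>n+1\<^esub>\<close> and \<open>z = x\<^bsub>n+2\<^esub>\<close>.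
\<close>

definition light_cone_cylinder :: "(real \<times> 'v::euclidean_space \<times> real) set" where
  "light_cone_cylinder = {(x1, y, z). (x1, y) \<in> light_cone}"

definition theta :: "real \<times> 'v::euclidean_space \<times> real \<Rightarrow> real \<times> 'v \<times> real" where
  "theta = (\<lambda>(x1, y, z). (x1, y, 0))"

text \<open>
  The components, in the patch, of the tangential part of the coordinate field of the last
  coordinate \<open>z\<close>.
\<close>

definition e1 :: "('a::euclidean_space \<Rightarrow> real \<times> 'v::euclidean_space \<times> real) \<Rightarrow> 'a \<Rightarrow> 'a" where
  "e1 f u = (THE v. differential f u v = tangent_part f u (0, 0, 1))"

text \<open>
  Exists and is unique for a codimension two space-like immersion into \<open>light_cone_cylinder\<close>;
  the value at a point does not depend on the patch.
\<close>

definition alpha :: "('a::euclidean_space \<Rightarrow> real \<times> 'v::euclidean_space \<times> real) \<Rightarrow> 'a \<Rightarrow> real" where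
  "alpha f u = (THE a. normal_connection f (e1 f) (theta \<circ> f) u = a *\<^sub>R theta (f u))"

end

theory Submission
  imports Defs
begin

text \<open>
  Write \<open>\<theta> = (x\<^sub>1, y, 0)\<close> for the light-like normal field and \<open>z\<close> for the last coordinate. In codimension
  two the orthogonal complement of \<open>\<theta>\<close> is the tangent space plus the line of \<open>\<theta>\<close>
  (\<open>null_vector_complement\<close>). Since \<open>\<partial>\<^sub>z\<close> is orthogonal to \<open>\<theta>\<close>, it follows that \<open>\<partial>\<^sub>z = e\<^sub>1 - \<alpha> \<theta>\<close> with
  \<open>e\<^sub>1\<close> tangent, and then \<open>dz(e\<^sub>1) = 1\<close> and \<open>d\<theta>(e\<^sub>1) = \<alpha> \<theta>\<close>. For an arbitrary tangent vector,
  \<open>\<nabla>\<^sup>\<bottom>\<^bsub>X\<^esub> \<theta> = \<alpha> dz(X) \<theta>\<close>: the connection form of \<open>\<theta>\<close> is \<open>\<alpha> dz\<close>, its curvature is \<open>d\<alpha> \<and> dz\<close>, and a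
  flat normal bundle forces \<open>\<alpha>\<close> to be locally a function of \<open>z\<close> alone
  (\<open>alpha_coeff_constant_on_slices\<close>).

  To turn this into a product, coordinates \<open>(s, t)\<close> with \<open>s = z\<close> and \<open>\<partial>\<^sub>s = e\<^sub>1\<close> are needed. They can be had
  without integrating \<open>e\<^sub>1\<close>: the direction \<open>y / x\<^sub>1\<close> of \<open>\<theta>\<close> does not change along \<open>e\<^sub>1\<close>, and together with
  \<open>z\<close> it is an immersion, so \<open>z\<close> and a suitable linear image of \<open>y / x\<^sub>1\<close> are coordinates by the inverse
  function theorem (\<open>adapted_coordinates\<close>). In them \<open>\<partial>\<^sub>s \<theta> = \<alpha>(s) \<theta>\<close>, whence \<open>\<theta>(s, t) / x\<^sub>1(s, t\<^sub>0)\<close> does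
  not depend on \<open>s\<close>. This quotient is \<open>\<gamma>(t)\<close>, and \<open>x\<^sub>1(s, t\<^sub>0)\<close> is the function \<open>\<alpha>h(s)\<close>
  (\<open>flat_imp_local_product\<close>).

  Conversely, on a local product \<open>\<zeta> = (\<gamma>, 0)\<close> is a null normal field. Its derivatives are those of the
  immersion along the slices \<open>s = const\<close>, divided by \<open>\<alpha>h\<close>, hence tangent, so \<open>\<zeta>\<close> is parallel. The
  null normal field \<open>\<eta>\<close> with \<open>\<langle>\<zeta>, \<eta>\<rangle> = 1\<close> is then parallel as well, and a bundle with a parallel frame is
  flat (\<open>flat_if_parallel_null_field\<close>).

  Both directions need some calculus for \<^const>\<open>Ck_on\<close>: the chain rule, smooth solutions of linear
  systems by Cramer's rule (for the projections and for the derivative of an inverse map), the symmetry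
  of second derivatives and the smooth inverse function theorem.
\<close>

section \<open>Calculus of \<open>C\<^sup>k\<close> and smooth maps\<close>

lemma Ck_on_imp_continuous_on: "Ck_on k U f \<Longrightarrow> continuous_on U f"
  by (cases k) (auto intro!: continuous_at_imp_continuous_on differentiable_imp_continuous_within)

lemma Ck_on_SucD: "Ck_on (Suc k) U f \<Longrightarrow> Ck_on k U f"
proof (induction k arbitrary: f)
  case 0
  then show ?case using Ck_on_imp_continuous_on by fastforce
next
  case (Suc k)
  then have "Ck_on k U (\<lambda>u. differential f u v)" for v
    using Suc.IH[of "\<lambda>u. differential f u v"] unfolding Ck_on.simps(2)[of "Suc k"] by simp
  then show ?case using Suc.prems unfolding Ck_on.simps(2) by simp
qed

lemma Ck_on_subset: "Ck_on k U f \<Longrightarrow> V \<subseteq> U \<Longrightarrow> Ck_on k V f"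
  by (induction k arbitrary: f) (auto intro: continuous_on_subset)

lemma Ck_on_cong:
  assumes "open U" "\<And>u. u \<in> U \<Longrightarrow> f u = g u" "Ck_on k U f"
  shows "Ck_on k U g"
  using assms(2,3)
proof (induction k arbitrary: f g)
  case 0
  then show ?case by (simp cong: continuous_on_cong)
next
  case (Suc k)
  have d: "(g has_derivative differential f u) (at u)" if "u \<in> U" for u
    using Suc.prems that assms(1)
    by (metis Ck_on.simps(2) frechet_derivative_works has_derivative_transform_within_open)
  show ?case
    unfolding Ck_on.simps
  proof (intro conjI ballI allI)
    fix u assume "u \<in> U" then show "g differentiable (at u)" using d differentiable_def by blast
  next
    fix v
    have "differential f u v = differential g u v" if "u \<in> U" for u
      using frechet_derivative_at[OF d[OF that]] by simp
    then show "Ck_on k U (\<lambda>u. differential g u v)"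
      by (rule Suc.IH) (use Suc.prems in simp_all)
  qed
qed

lemma Ck_on_SucI:
  assumes "open U" "\<And>u. u \<in> U \<Longrightarrow> (f has_derivative f' u) (at u)"
    "\<And>v. Ck_on k U (\<lambda>u. f' u v)"
  shows "Ck_on (Suc k) U f"
  unfolding Ck_on.simps
proof (intro conjI ballI allI)
  fix u assume "u \<in> U" then show "f differentiable (at u)" using assms(2) differentiable_def by blast
next
  fix v
  show "Ck_on k U (\<lambda>u. differential f u v)"
    by (rule Ck_on_cong[OF assms(1) _ assms(3)[of v]]) (simp add: frechet_derivative_at[OF assms(2), symmetric])
qed

lemma Ck_on_Suc_has_derivative:
  "Ck_on (Suc k) U f \<Longrightarrow> u \<in> U \<Longrightarrow> (f has_derivative differential f u) (at u)"
  using frechet_derivative_works by auto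

lemma Ck_on_const: "open U \<Longrightarrow> Ck_on k U (\<lambda>u. c)"
  by (induction k arbitrary: c) auto

lemma Ck_on_bounded_linear:
  assumes "open U" "bounded_linear L" "Ck_on k U f"
  shows "Ck_on k U (\<lambda>u. L (f u))"
  using assms(3)
proof (induction k arbitrary: f)
  case 0
  then show ?case using assms(2) bounded_linear.continuous_on by auto
next
  case (Suc k)
  have "Ck_on k U (\<lambda>u. L (differential f u v))" for v
    using Suc.prems by (intro Suc.IH) simp
  then show ?case
    using bounded_linear.has_derivative[OF assms(2) Ck_on_Suc_has_derivative[OF Suc.prems]]
    by (rule Ck_on_SucI[OF assms(1), rotated])
qed

lemma Ck_on_id: "open U \<Longrightarrow> Ck_on k U (\<lambda>u. u)"
proof (cases k)
  case (Suc n)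
  assume "open U"
  then show ?thesis unfolding Suc
    by (intro Ck_on_SucI[where f'="\<lambda>u v. v"] Ck_on_const) auto
qed auto

lemma Ck_on_add:
  assumes "open U" "Ck_on k U f" "Ck_on k U g"
  shows "Ck_on k U (\<lambda>u. f u + g u)"
  using assms(2,3)
proof (induction k arbitrary: f g)
  case 0
  then show ?case by (auto intro: continuous_intros)
next
  case (Suc k)
  have "Ck_on k U (\<lambda>u. differential f u v + differential g u v)" for v
    using Suc.prems by (intro Suc.IH) simp_all
  then show ?case
    using has_derivative_add[OF Ck_on_Suc_has_derivative[OF Suc.prems(1)]
        Ck_on_Suc_has_derivative[OF Suc.prems(2)]]
    by (rule Ck_on_SucI[OF assms(1), rotated])
qed

lemma Ck_on_sum:
  assumes "open U" "\<And>i. i \<in> I \<Longrightarrow> Ck_on k U (f i)"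
  shows "Ck_on k U (\<lambda>u. \<Sum>i\<in>I. f i u)"
  using assms(2)
  by (induction I rule: infinite_finite_induct) (auto intro: Ck_on_add Ck_on_const assms(1))

lemma Ck_on_bounded_bilinear:
  assumes "open U" "bounded_bilinear h" "Ck_on k U f" "Ck_on k U g"
  shows "Ck_on k U (\<lambda>u. h (f u) (g u))"
  using assms(3,4)
proof (induction k arbitrary: f g)
  case 0
  then show ?case using bounded_bilinear.continuous_on[OF assms(2)] by auto
next
  case (Suc k)
  show ?case
  proof (rule Ck_on_SucI[OF assms(1),
          where f'="\<lambda>u v. h (f u) (differential g u v) + h (differential f u v) (g u)"])
    show "((\<lambda>u. h (f u) (g u)) has_derivative
        (\<lambda>v. h (f u) (differential g u v) + h (differential f u v) (g u))) (at u)" if "u \<in> U" for u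
      using bounded_bilinear.FDERIV[OF assms(2) Ck_on_Suc_has_derivative[OF Suc.prems(1) that]
          Ck_on_Suc_has_derivative[OF Suc.prems(2) that]] .
    show "Ck_on k U (\<lambda>u. h (f u) (differential g u v) + h (differential f u v) (g u))" for v
      using Suc.prems Suc.prems[THEN Ck_on_SucD] by (intro Ck_on_add assms(1) Suc.IH) simp_all
  qed
qed

lemma Ck_on_inverse:
  fixes f :: "'a::euclidean_space \<Rightarrow> real"
  assumes "open U" "Ck_on k U f" "\<And>u. u \<in> U \<Longrightarrow> f u \<noteq> 0"
  shows "Ck_on k U (\<lambda>u. inverse (f u))"
  using assms(2)
proof (induction k)
  case 0
  then show ?case using assms(3) by (auto intro: continuous_intros)
next
  case (Suc k)
  have IH: "Ck_on k U (\<lambda>u. inverse (f u))" using Suc Ck_on_SucD by blast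
  show ?case
  proof (rule Ck_on_SucI[OF assms(1),
          where f'="\<lambda>u v. - (inverse (f u) * differential f u v * inverse (f u))"])
    show "((\<lambda>u. inverse (f u)) has_derivative
        (\<lambda>v. - (inverse (f u) * differential f u v * inverse (f u)))) (at u)" if "u \<in> U" for u
      using Deriv.has_derivative_inverse[OF assms(3)[OF that] Ck_on_Suc_has_derivative[OF Suc.prems that]] .
    show "Ck_on k U (\<lambda>u. - (inverse (f u) * differential f u v * inverse (f u)))" for v
      using Suc.prems
      by (intro Ck_on_bounded_linear[where L=uminus] bounded_linear_minus bounded_linear_ident
          Ck_on_bounded_bilinear[OF assms(1) bounded_bilinear_mult] IH assms(1)) auto
  qed
qed

lemma Ck_on_componentwise:
  assumes "open U" "\<And>b. b \<in> Basis \<Longrightarrow> Ck_on k U (\<lambda>u. f u \<bullet> b)"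
  shows "Ck_on k U f"
proof -
  have "Ck_on k U (\<lambda>u. \<Sum>b\<in>Basis. (f u \<bullet> b) *\<^sub>R b)"
    by (intro Ck_on_sum Ck_on_bounded_linear[where L="\<lambda>c. c *\<^sub>R _"] assms bounded_linear_scaleR_left)
  then show ?thesis by (simp add: euclidean_representation)
qed

text \<open>
  Induction over \<open>k\<close> goes through because the chain rule, expanded along a basis, writes the derivative
  of the composition as a sum of products of \<open>C\<^sup>k\<close> functions with compositions of \<open>C\<^sup>k\<close> functions.
\<close>

lemma Ck_on_compose:
  fixes f :: "'b::euclidean_space \<Rightarrow> 'c::euclidean_space" and g :: "'a::euclidean_space \<Rightarrow> 'b"
  assumes "open U" "open V" "g ` U \<subseteq> V" "Ck_on k V f" "Ck_on k U g"
  shows "Ck_on k U (\<lambda>u. f (g u))"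
  using assms(4,5)
proof (induction k arbitrary: f)
  case 0
  then show ?case using assms(3) continuous_on_compose2 by fastforce
next
  case (Suc k)
  let ?f' = "\<lambda>u v. \<Sum>b\<in>Basis. (differential g u v \<bullet> b) *\<^sub>R differential f (g u) b"
  show ?case
  proof (rule Ck_on_SucI[OF assms(1), where f'="?f'"])
    fix u assume u: "u \<in> U"
    have df: "(f has_derivative differential f (g u)) (at (g u))"
      using Ck_on_Suc_has_derivative Suc.prems(1) assms(3) u by blast
    then interpret linear "differential f (g u)" by (rule has_derivative_linear)
    have "(\<Sum>b\<in>Basis. (w \<bullet> b) *\<^sub>R differential f (g u) b)
        = differential f (g u) (\<Sum>b\<in>Basis. (w \<bullet> b) *\<^sub>R b)" for w
      by (simp only: sum scale)
    then have eq: "?f' u = (\<lambda>v. differential f (g u) (differential g u v))"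
      unfolding euclidean_representation by (intro ext)
    show "((\<lambda>u. f (g u)) has_derivative ?f' u) (at u)"
      unfolding eq by (rule has_derivative_compose[OF Ck_on_Suc_has_derivative[OF Suc.prems(2) u] df])
  next
    fix v
    show "Ck_on k U (\<lambda>u. ?f' u v)"
    proof (intro Ck_on_sum Ck_on_bounded_bilinear[OF _ bounded_bilinear_scaleR] assms(1))
      show "Ck_on k U (\<lambda>u. differential g u v \<bullet> b)" for b
        using Suc.prems(2) by (intro Ck_on_bounded_linear[where L="\<lambda>x. x \<bullet> b"] assms(1) bounded_linear_inner_left_comp)
          (auto intro: bounded_linear_inner_left)
      show "Ck_on k U (\<lambda>u. differential f (g u) b)" for b
        using Suc.prems(1) by (intro Suc.IH Ck_on_SucD[OF Suc.prems(2)]) auto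
    qed
  qed
qed

lemma Ck_on_prod:
  fixes f :: "'i \<Rightarrow> 'a::euclidean_space \<Rightarrow> real"
  assumes "open U" "\<And>i. i \<in> I \<Longrightarrow> Ck_on k U (f i)"
  shows "Ck_on k U (\<lambda>u. \<Prod>i\<in>I. f i u)"
  using assms(2)
  by (induction I rule: infinite_finite_induct)
    (auto intro: Ck_on_bounded_bilinear[OF assms(1) bounded_bilinear_mult] Ck_on_const assms(1))

lemma Ck_on_det:
  fixes M :: "'a::euclidean_space \<Rightarrow> real^'n^'n"
  assumes "open U" "\<And>i j. Ck_on k U (\<lambda>u. M u $ i $ j)"
  shows "Ck_on k U (\<lambda>u. det (M u))"
  unfolding det_def
  by (intro Ck_on_sum Ck_on_bounded_bilinear[OF assms(1) bounded_bilinear_mult] Ck_on_const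
      Ck_on_prod assms)

text \<open>
  Cramer's rule expresses the solution of a linear system rationally in its coefficients, so the solution
  is as smooth as the coefficients and the right-hand side.
\<close>

lemma Ck_on_linear_solve:
  fixes A :: "'a::euclidean_space \<Rightarrow> real^'n \<Rightarrow> real^'n"
  assumes "open U"
    and lin: "\<And>u. u \<in> U \<Longrightarrow> linear (A u)" and inj: "\<And>u. u \<in> U \<Longrightarrow> inj (A u)"
    and A: "\<And>v. Ck_on k U (\<lambda>u. A u v)" and b: "Ck_on k U b"
    and sol: "\<And>u. u \<in> U \<Longrightarrow> A u (c u) = b u"
  shows "Ck_on k U c"
proof -
  define M where "M u = matrix (A u)" for u
  have M: "Ck_on k U (\<lambda>u. M u $ i $ j)" for i j
    unfolding M_def matrix_def
    using Ck_on_bounded_linear[OF assms(1) bounded_linear_vec_nth A, of "axis j 1" i]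
    by simp
  have b': "Ck_on k U (\<lambda>u. b u $ i)" for i
    by (intro Ck_on_bounded_linear[OF assms(1) bounded_linear_vec_nth b])
  have d0: "det (M u) \<noteq> 0" if "u \<in> U" for u
    unfolding M_def using det_nz_iff_inj[OF lin[OF that]] inj[OF that] by simp
  have c: "c u $ l = det (\<chi> i j. if j = l then b u $ i else M u $ i $ j) * inverse (det (M u))"
    if "u \<in> U" for u l
  proof -
    have "M u *v c u = b u" unfolding M_def using lin[OF that] sol[OF that] by (simp add: matrix_works)
    then show ?thesis using cramer[OF d0[OF that]] by (simp add: divide_inverse)
  qed
  have N: "Ck_on k U (\<lambda>u. det (\<chi> i j. if j = l then b u $ i else M u $ i $ j))" for l
  proof (rule Ck_on_det[OF assms(1)])
    fix i j
    show "Ck_on k U (\<lambda>u. (\<chi> i j. if j = l then b u $ i else M u $ i $ j) $ i $ j)"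
      by (cases "j = l") (simp_all add: M b')
  qed
  have "Ck_on k U (\<lambda>u. det (\<chi> i j. if j = l then b u $ i else M u $ i $ j) * inverse (det (M u)))" for l
    by (rule Ck_on_bounded_bilinear[OF assms(1) bounded_bilinear_mult N
          Ck_on_inverse[OF assms(1) Ck_on_det[OF assms(1) M] d0]])
  note sol_smooth = this
  show ?thesis
  proof (rule Ck_on_componentwise[OF assms(1)])
    fix e :: "real^'n" assume "e \<in> Basis"
    then obtain l where e: "e = axis l 1" unfolding Basis_vec_def by auto
    show "Ck_on k U (\<lambda>u. c u \<bullet> e)"
    proof (rule Ck_on_cong[OF assms(1) _ sol_smooth[of l]])
      show "det (\<chi> i j. if j = l then b u $ i else M u $ i $ j) * inverse (det (M u)) = c u \<bullet> e"
        if "u \<in> U" for u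
        unfolding e inner_axis using c[OF that, of l] by (simp only: inner_real_def mult_1_right)
    qed
  qed
qed

lemma smooth_on_subset: "smooth_on U f \<Longrightarrow> V \<subseteq> U \<Longrightarrow> smooth_on V f"
  unfolding smooth_on_def using Ck_on_subset by blast

lemma smooth_on_cong: "open U \<Longrightarrow> (\<And>u. u \<in> U \<Longrightarrow> f u = g u) \<Longrightarrow> smooth_on U f \<Longrightarrow> smooth_on U g"
  unfolding smooth_on_def using Ck_on_cong by metis

lemma smooth_on_continuous_on: "smooth_on U f \<Longrightarrow> continuous_on U f"
  unfolding smooth_on_def using Ck_on_imp_continuous_on by blast

lemma smooth_on_has_derivative:
  "smooth_on U f \<Longrightarrow> u \<in> U \<Longrightarrow> (f has_derivative differential f u) (at u)"
  unfolding smooth_on_def using Ck_on_Suc_has_derivative by blast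

lemma smooth_on_differential: "smooth_on U f \<Longrightarrow> smooth_on U (\<lambda>u. differential f u v)"
  unfolding smooth_on_def using Ck_on.simps(2) by blast

lemma smooth_on_const: "open U \<Longrightarrow> smooth_on U (\<lambda>u. c)"
  by (simp add: smooth_on_def Ck_on_const)

lemma smooth_on_id: "open U \<Longrightarrow> smooth_on U (\<lambda>u. u)"
  by (simp add: smooth_on_def Ck_on_id)

lemma smooth_on_bounded_linear:
  "open U \<Longrightarrow> bounded_linear L \<Longrightarrow> smooth_on U f \<Longrightarrow> smooth_on U (\<lambda>u. L (f u))"
  by (simp add: smooth_on_def Ck_on_bounded_linear)

lemma smooth_on_add: "open U \<Longrightarrow> smooth_on U f \<Longrightarrow> smooth_on U g \<Longrightarrow> smooth_on U (\<lambda>u. f u + g u)"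
  by (simp add: smooth_on_def Ck_on_add)

lemma smooth_on_bounded_bilinear:
  "open U \<Longrightarrow> bounded_bilinear h \<Longrightarrow> smooth_on U f \<Longrightarrow> smooth_on U g \<Longrightarrow> smooth_on U (\<lambda>u. h (f u) (g u))"
  by (simp add: smooth_on_def Ck_on_bounded_bilinear)

lemma smooth_on_sum:
  "open U \<Longrightarrow> (\<And>i. i \<in> I \<Longrightarrow> smooth_on U (f i)) \<Longrightarrow> smooth_on U (\<lambda>u. \<Sum>i\<in>I. f i u)"
  by (simp add: smooth_on_def Ck_on_sum)

lemma smooth_on_inverse:
  fixes f :: "'a::euclidean_space \<Rightarrow> real"
  shows "open U \<Longrightarrow> smooth_on U f \<Longrightarrow> (\<And>u. u \<in> U \<Longrightarrow> f u \<noteq> 0) \<Longrightarrow> smooth_on U (\<lambda>u. inverse (f u))"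
  by (simp add: smooth_on_def Ck_on_inverse)

lemma smooth_on_compose:
  "open U \<Longrightarrow> open V \<Longrightarrow> g ` U \<subseteq> V \<Longrightarrow> smooth_on V f \<Longrightarrow> smooth_on U g \<Longrightarrow> smooth_on U (\<lambda>u. f (g u))"
  unfolding smooth_on_def using Ck_on_compose by metis

lemma smooth_on_differential_field:
  assumes "open U" "smooth_on U f" "smooth_on U X"
  shows "smooth_on U (\<lambda>u. differential f u (X u))"
proof -
  have "smooth_on U (\<lambda>u. \<Sum>b\<in>Basis. (X u \<bullet> b) *\<^sub>R differential f u b)"
    by (intro smooth_on_sum smooth_on_bounded_bilinear[OF _ bounded_bilinear_scaleR] assms
        smooth_on_differential smooth_on_bounded_linear[OF _ bounded_linear_inner_left])
  then show ?thesis
  proof (rule smooth_on_cong[OF assms(1), rotated])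
    fix u assume "u \<in> U"
    then interpret linear "differential f u"
      using has_derivative_linear smooth_on_has_derivative[OF assms(2)] by blast
    show "(\<Sum>b\<in>Basis. (X u \<bullet> b) *\<^sub>R differential f u b) = differential f u (X u)"
      using sum[of "\<lambda>b. (X u \<bullet> b) *\<^sub>R b" Basis] unfolding scale euclidean_representation ..
  qed
qed

lemma smooth_on_Pair:
  assumes "open U" "smooth_on U f" "smooth_on U g"
  shows "smooth_on U (\<lambda>u. (f u, g u))"
proof -
  have "smooth_on U (\<lambda>u. (f u, 0) + (0, g u))"
    by (intro smooth_on_add smooth_on_bounded_linear[where L="\<lambda>x. (x,0)"]
        smooth_on_bounded_linear[where L="\<lambda>x. (0,x)"] assms bounded_linear_Pair
        bounded_linear_ident bounded_linear_zero)
  then show ?thesis by simp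
qed

lemma smooth_on_fst: "open U \<Longrightarrow> smooth_on U f \<Longrightarrow> smooth_on U (\<lambda>u. fst (f u))"
  by (rule smooth_on_bounded_linear[OF _ bounded_linear_fst])

lemma smooth_on_snd: "open U \<Longrightarrow> smooth_on U f \<Longrightarrow> smooth_on U (\<lambda>u. snd (f u))"
  by (rule smooth_on_bounded_linear[OF _ bounded_linear_snd])

lemmas smooth_on_scaleR = smooth_on_bounded_bilinear[OF _ bounded_bilinear_scaleR]
  and smooth_on_mult = smooth_on_bounded_bilinear[OF _ bounded_bilinear_mult]

lemma smooth_on_minus: "open U \<Longrightarrow> smooth_on U f \<Longrightarrow> smooth_on U (\<lambda>u. - f u)"
  by (rule smooth_on_bounded_linear[OF _ bounded_linear_minus[OF bounded_linear_ident]])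

lemma smooth_on_diff: "open U \<Longrightarrow> smooth_on U f \<Longrightarrow> smooth_on U g \<Longrightarrow> smooth_on U (\<lambda>u. f u - g u)"
  using smooth_on_add[of U f "\<lambda>u. - g u"] smooth_on_minus by auto

lemma smooth_on_linear_solve:
  fixes A :: "'a::euclidean_space \<Rightarrow> real^'n \<Rightarrow> real^'n"
  assumes "open U" "\<And>u. u \<in> U \<Longrightarrow> linear (A u)" "\<And>u. u \<in> U \<Longrightarrow> inj (A u)"
    "\<And>v. smooth_on U (\<lambda>u. A u v)" "smooth_on U b" "\<And>u. u \<in> U \<Longrightarrow> A u (c u) = b u"
  shows "smooth_on U c"
  unfolding smooth_on_def
proof
  show "Ck_on k U c" for k
    by (rule Ck_on_linear_solve[of U A k b]) (use assms in \<open>auto simp: smooth_on_def\<close>)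
qed

section \<open>Symmetry of second derivatives\<close>

text \<open>
  The second difference is symmetric in \<open>v\<close> and \<open>w\<close>, whereas applying the mean value theorem first along
  \<open>v\<close> and then along \<open>w\<close> yields a mixed derivative in that order. Comparing both orders as \<open>t\<close> tends to
  zero gives Schwarz's theorem.
\<close>

lemma second_difference_mean_value:
  fixes g :: "'a::euclidean_space \<Rightarrow> real"
  assumes "smooth_on U g" "t > 0"
    "\<And>a b. 0 \<le> a \<Longrightarrow> a \<le> t \<Longrightarrow> 0 \<le> b \<Longrightarrow> b \<le> t \<Longrightarrow> u + a *\<^sub>R v + b *\<^sub>R w \<in> U"
  obtains a b where "0 < a" "a < t" "0 < b" "b < t"
    "g (u + t *\<^sub>R v + t *\<^sub>R w) - g (u + t *\<^sub>R v) - g (u + t *\<^sub>R w) + g u =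
      t * t * differential (\<lambda>x. differential g x v) (u + a *\<^sub>R v + b *\<^sub>R w) w"
proof -
  define G where "G x = differential g x v" for x
  have dg: "(g has_derivative differential g x) (at x)" if "x \<in> U" for x
    using smooth_on_has_derivative[OF assms(1) that] .
  have dG: "(G has_derivative differential G x) (at x)" if "x \<in> U" for x
    using smooth_on_has_derivative[OF smooth_on_differential[OF assms(1)] that]
    unfolding G_def[abs_def] .
  define h where "h s = g (u + s *\<^sub>R v + t *\<^sub>R w) - g (u + s *\<^sub>R v)" for s
  have dh: "(h has_real_derivative G (u + s *\<^sub>R v + t *\<^sub>R w) - G (u + s *\<^sub>R v)) (at s)"
    if "0 \<le> s" "s \<le> t" for s
  proof -
    have 1: "((\<lambda>s. u + s *\<^sub>R v + t *\<^sub>R w) has_derivative (\<lambda>r. r *\<^sub>R v)) (at s)"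
      and 2: "((\<lambda>s. u + s *\<^sub>R v) has_derivative (\<lambda>r. r *\<^sub>R v)) (at s)"
      by (auto intro!: derivative_eq_intros)
    have U1: "u + s *\<^sub>R v + t *\<^sub>R w \<in> U" and U2: "u + s *\<^sub>R v \<in> U"
      using assms(3)[OF that, of t] assms(3)[OF that, of 0] assms(2) by simp_all
    have lin: "linear (differential g x)" if "x \<in> U" for x
      using dg[OF that] has_derivative_linear by blast
    have eq: "(\<lambda>r. differential g (u + s *\<^sub>R v + t *\<^sub>R w) (r *\<^sub>R v) - differential g (u + s *\<^sub>R v) (r *\<^sub>R v))
        = (*) (differential g (u + s *\<^sub>R v + t *\<^sub>R w) v - differential g (u + s *\<^sub>R v) v)"
      unfolding linear_scale[OF lin[OF U1]] linear_scale[OF lin[OF U2]] by (simp add: fun_eq_iff algebra_simps)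
    have "(h has_derivative (\<lambda>r. differential g (u + s *\<^sub>R v + t *\<^sub>R w) (r *\<^sub>R v) -
         differential g (u + s *\<^sub>R v) (r *\<^sub>R v))) (at s)"
      unfolding h_def[abs_def]
      by (rule has_derivative_diff[OF has_derivative_compose[OF 1 dg[OF U1]]
          has_derivative_compose[OF 2 dg[OF U2]]])
    then show ?thesis
      unfolding has_field_derivative_def G_def eq .
  qed
  obtain a where a: "0 < a" "a < t" "h t - h 0 = t * (G (u + a *\<^sub>R v + t *\<^sub>R w) - G (u + a *\<^sub>R v))"
    using MVT2[OF assms(2) dh] by auto
  define k where "k s = G (u + a *\<^sub>R v + s *\<^sub>R w)" for s
  have dk: "(k has_real_derivative differential G (u + a *\<^sub>R v + s *\<^sub>R w) w) (at s)"
    if "0 \<le> s" "s \<le> t" for s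
  proof -
    have 1: "((\<lambda>s. u + a *\<^sub>R v + s *\<^sub>R w) has_derivative (\<lambda>r. r *\<^sub>R w)) (at s)"
      by (auto intro!: derivative_eq_intros)
    have U1: "u + a *\<^sub>R v + s *\<^sub>R w \<in> U" using assms(3) that a by auto
    have lin: "linear (differential G (u + a *\<^sub>R v + s *\<^sub>R w))"
      using dG[OF U1] has_derivative_linear by blast
    show ?thesis
      unfolding has_field_derivative_def k_def
      using has_derivative_compose[OF 1 dG[OF U1]] by (simp add: linear_scale[OF lin] mult_commute_abs)
  qed
  obtain b where b: "0 < b" "b < t" "k t - k 0 = t * differential G (u + a *\<^sub>R v + b *\<^sub>R w) w"
    using MVT2[OF assms(2) dk] by auto
  have "g (u + t *\<^sub>R v + t *\<^sub>R w) - g (u + t *\<^sub>R v) - g (u + t *\<^sub>R w) + g u = h t - h 0"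
    by (simp add: h_def)
  also have "\<dots> = t * (k t - k 0)" using a by (simp add: k_def)
  also have "\<dots> = t * t * differential G (u + a *\<^sub>R v + b *\<^sub>R w) w" using b by simp
  finally show thesis using that a b unfolding G_def[abs_def] by blast
qed

lemma symmetric_second_differential_real:
  fixes g :: "'a::euclidean_space \<Rightarrow> real"
  assumes "open U" "smooth_on U g" "u \<in> U"
  shows "differential (\<lambda>x. differential g x v) u w = differential (\<lambda>x. differential g x w) u v"
proof -
  define P where "P v w x = differential (\<lambda>x. differential g x v) x w" for v w x
  have cont: "isCont (P v w) u" for v w
    unfolding P_def[abs_def]
    using smooth_on_continuous_on[OF smooth_on_differential[OF smooth_on_differential[OF assms(2)]]] assms(1,3)
      continuous_on_eq_continuous_at by blast
  have "\<bar>P v w u - P w v u\<bar> \<le> e" if "e > 0" for e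
  proof -
    have near: "\<exists>d>0. \<forall>x. dist x u < d \<longrightarrow> dist (P v w x) (P v w u) < e/2" for v w
      using cont[of v w] \<open>e > 0\<close> unfolding continuous_at_eps_delta by (metis half_gt_zero)
    obtain d1 where d1: "d1 > 0" "\<And>x. dist x u < d1 \<Longrightarrow> dist (P v w x) (P v w u) < e/2"
      using near[of v w] by blast
    obtain d2 where d2: "d2 > 0" "\<And>x. dist x u < d2 \<Longrightarrow> dist (P w v x) (P w v u) < e/2"
      using near[of w v] by blast
    obtain d3 where d3: "d3 > 0" "\<And>x. dist x u < d3 \<Longrightarrow> x \<in> U"
      using assms(1,3) unfolding open_dist by blast
    define d where "d = min d1 (min d2 d3)"
    have d: "d > 0" "\<And>x. dist x u < d \<Longrightarrow>
       dist (P v w x) (P v w u) < e/2 \<and> dist (P w v x) (P w v u) < e/2 \<and> x \<in> U"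
      using d1 d2 d3 unfolding d_def by auto
    \<comment> \<open>Small enough to keep the whole parallelogram inside the ball of radius \<open>d\<close>.\<close>
  define t where "t = d / (2 * (norm v + norm w + 1))"
    have den: "norm v + norm w + 1 > 0" by (smt (verit) norm_ge_zero)
    have t0: "t > 0" unfolding t_def using d den by simp
    have ball: "dist (u + a *\<^sub>R v + b *\<^sub>R w) u < d" if "0 \<le> a" "a \<le> t" "0 \<le> b" "b \<le> t" for a b
    proof -
      have "dist (u + a *\<^sub>R v + b *\<^sub>R w) u = norm (a *\<^sub>R v + b *\<^sub>R w)"
        by (simp add: dist_norm algebra_simps)
      also have "\<dots> \<le> a * norm v + b * norm w"
        using that by (metis abs_of_nonneg norm_scaleR norm_triangle_ineq)
      also have "\<dots> \<le> t * norm v + t * norm w"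
        using that by (intro add_mono mult_right_mono) auto
      also have "\<dots> < 2 * (t * (norm v + norm w + 1))"
        using t0 by (simp add: algebra_simps) (smt (verit) mult_nonneg_nonneg norm_ge_zero)
      also have "\<dots> = d" unfolding t_def using den by (simp add: field_simps)
      finally show ?thesis .
    qed
    obtain a b where ab: "0 < a" "a < t" "0 < b" "b < t"
      "g (u + t *\<^sub>R v + t *\<^sub>R w) - g (u + t *\<^sub>R v) - g (u + t *\<^sub>R w) + g u = t * t * P v w (u + a *\<^sub>R v + b *\<^sub>R w)"
      unfolding P_def
      by (rule second_difference_mean_value[OF assms(2) t0, of u v w]) (use d ball in auto)
    have swap: "u + b *\<^sub>R w + a *\<^sub>R v = u + a *\<^sub>R v + b *\<^sub>R w" for a b
      by (simp add: add_ac)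
    have inU: "u + b *\<^sub>R w + a *\<^sub>R v \<in> U" if "0 \<le> b" "b \<le> t" "0 \<le> a" "a \<le> t" for a b
      unfolding swap using d(2) ball that by blast
    obtain b' a' where ab': "0 < a'" "a' < t" "0 < b'" "b' < t"
      "g (u + t *\<^sub>R w + t *\<^sub>R v) - g (u + t *\<^sub>R w) - g (u + t *\<^sub>R v) + g u = t * t * P w v (u + b' *\<^sub>R w + a' *\<^sub>R v)"
      unfolding P_def
      by (rule second_difference_mean_value[OF assms(2) t0, of u w v])
        (use inU in auto)
    have "P v w (u + a *\<^sub>R v + b *\<^sub>R w) = P w v (u + b' *\<^sub>R w + a' *\<^sub>R v)"
    proof -
      have "t * t * P v w (u + a *\<^sub>R v + b *\<^sub>R w) = t * t * P w v (u + b' *\<^sub>R w + a' *\<^sub>R v)"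
        using ab(5) ab'(5) unfolding swap[of t t] by linarith
      then show ?thesis using t0 by simp
    qed
    moreover have "dist (P v w (u + a *\<^sub>R v + b *\<^sub>R w)) (P v w u) < e/2"
      using d ball ab by simp
    moreover have "dist (P w v (u + b' *\<^sub>R w + a' *\<^sub>R v)) (P w v u) < e/2"
      unfolding swap using d ball[of a' b'] ab' by simp
    ultimately have "dist (P v w u) (P w v u) < e"
      by (metis dist_triangle_half_r)
    then show ?thesis unfolding dist_real_def by simp
  qed
  then have "\<bar>P v w u - P w v u\<bar> \<le> 0" by (rule field_le_epsilon) simp
  then show ?thesis unfolding P_def by simp
qed

lemma differential_eq: "(f has_derivative f') (at u) \<Longrightarrow> differential f u = f'"
  by (rule frechet_derivative_at[symmetric])

lemma differential_cong:
  assumes "open U" "u \<in> U" "\<And>x. x \<in> U \<Longrightarrow> f x = g x"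
  shows "differential f u = differential g u"
proof -
  have "(f has_derivative D) (at u) \<longleftrightarrow> (g has_derivative D) (at u)" for D
    using assms has_derivative_transform_within_open[of f D u UNIV U g]
      has_derivative_transform_within_open[of g D u UNIV U f] by auto
  then show ?thesis unfolding frechet_derivative_def by simp
qed

lemma linear_differential: "smooth_on U f \<Longrightarrow> u \<in> U \<Longrightarrow> linear (differential f u)"
  using smooth_on_has_derivative has_derivative_linear by blast

lemma symmetric_second_differential:
  fixes g :: "'a::euclidean_space \<Rightarrow> 'b::euclidean_space"
  assumes "open U" "smooth_on U g" "u \<in> U"
  shows "differential (\<lambda>x. differential g x v) u w = differential (\<lambda>x. differential g x w) u v"
proof (rule euclidean_eqI)
  fix b :: 'b
  have comp: "differential (\<lambda>x. f x \<bullet> b) x = (\<lambda>v. differential f x v \<bullet> b)"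
    if "smooth_on U f" "x \<in> U" for f :: "'a \<Rightarrow> 'b" and x
    by (intro differential_eq bounded_linear.has_derivative[OF bounded_linear_inner_left]
        smooth_on_has_derivative[of U] that)
  have "differential (\<lambda>x. differential g x v) u w \<bullet> b
      = differential (\<lambda>x. differential (\<lambda>x. g x \<bullet> b) x v) u w" for v w
  proof -
    have "differential (\<lambda>x. differential (\<lambda>x. g x \<bullet> b) x v) u
        = differential (\<lambda>x. differential g x v \<bullet> b) u"
      by (rule differential_cong[OF assms(1,3)]) (simp add: comp assms(2))
    then show ?thesis
      using comp[OF smooth_on_differential[OF assms(2)] assms(3)] by simp
  qed
  then show "differential (\<lambda>x. differential g x v) u w \<bullet> b
      = differential (\<lambda>x. differential g x w) u v \<bullet> b"
    using symmetric_second_differential_real[OF assms(1) _ assms(3)]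
      smooth_on_bounded_linear[OF assms(1) bounded_linear_inner_left assms(2)] by metis
qed

section \<open>The smooth inverse function theorem\<close>

lemma differential_compose:
  assumes "smooth_on U f" "smooth_on V g" "u \<in> V" "g u \<in> U"
  shows "differential (\<lambda>u. f (g u)) u = (\<lambda>v. differential f (g u) (differential g u v))"
  by (rule differential_eq[OF has_derivative_compose[OF smooth_on_has_derivative[OF assms(2,3)]
        smooth_on_has_derivative[OF assms(1,4)]]])

text \<open>
  Bootstrapping: \<open>g'\<close> solves a linear system whose coefficients are the derivatives of \<open>G\<close> composed with
  \<open>g\<close>, hence \<open>g'\<close> is \<open>C\<^sup>k\<close> as soon as \<open>g\<close> is.
\<close>

lemma Ck_on_inverse_map:
  fixes G g :: "real^'n \<Rightarrow> real^'n"
  assumes "open U" "open V" "smooth_on U G" "g ` V \<subseteq> U"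
    and dg: "\<And>y. y \<in> V \<Longrightarrow> (g has_derivative g' y) (at y)"
    and inj: "\<And>y. y \<in> V \<Longrightarrow> inj (differential G (g y))"
    and inv: "\<And>y v. y \<in> V \<Longrightarrow> differential G (g y) (g' y v) = v"
  shows "Ck_on k V g"
proof (induction k)
  case 0
  have "isCont g y" if "y \<in> V" for y using has_derivative_continuous[OF dg[OF that]] by simp
  then show ?case by (simp add: continuous_at_imp_continuous_on)
next
  case (Suc k)
  show ?case
  proof (rule Ck_on_SucI[OF \<open>open V\<close> dg])
    show "Ck_on k V (\<lambda>y. g' y v)" for v
    proof (rule Ck_on_linear_solve[where A="\<lambda>y. differential G (g y)" and b="\<lambda>y. v"])
      show "Ck_on k V (\<lambda>y. differential G (g y) w)" for w
        by (rule Ck_on_compose[OF \<open>open V\<close> \<open>open U\<close> \<open>g ` V \<subseteq> U\<close> _ Suc])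
          (use smooth_on_differential[OF \<open>smooth_on U G\<close>] in \<open>auto simp: smooth_on_def\<close>)
      show "linear (differential G (g y))" if "y \<in> V" for y
        using linear_differential[OF \<open>smooth_on U G\<close>] assms(4) that by blast
    qed (use assms in \<open>auto intro: Ck_on_const\<close>)
  qed
qed

text \<open>
  The target may be any Euclidean space of the right dimension; a linear isomorphism reduces this to the
  inverse function theorem for maps of a space to itself.
\<close>

theorem smooth_inverse_function:
  fixes F :: "real^'n \<Rightarrow> 'b::euclidean_space"
  assumes "open U" "smooth_on U F" "p \<in> U" "inj (differential F p)" "DIM('b) = CARD('n)"
  obtains W W' H where "open W" "W \<subseteq> U" "p \<in> W" "open W'" "homeomorphism W W' F H" "smooth_on W' H"
proof -
  obtain J :: "'b \<Rightarrow> real^'n" and K where JK: "linear J" "linear K" "\<And>x. K (J x) = x" "\<And>y. J (K y) = y"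
  proof -
    have "DIM('b) = DIM(real^'n)" using assms(5) by simp
    from isomorphisms_UNIV_UNIV[OF this] obtain J :: "'b \<Rightarrow> real^'n" and K
      where "linear J" "linear K" "\<And>x. K (J x) = x" "\<And>y. J (K y) = y"
      by metis
    then show thesis using that by blast
  qed
  have bJ: "bounded_linear J"
    using JK linear_conv_bounded_linear by auto
  define G where "G u = J (F u)" for u
  have sG: "smooth_on U G" unfolding G_def[abs_def] by (rule smooth_on_bounded_linear[OF assms(1) bJ assms(2)])
  have dG: "differential G u = (\<lambda>v. J (differential F u v))" if "u \<in> U" for u
    unfolding G_def[abs_def]
    by (intro differential_eq bounded_linear.has_derivative[OF bJ] smooth_on_has_derivative[OF assms(2) that])
  define G' where "G' u = Blinfun (differential G u)" for u
  have G': "blinfun_apply (G' u) = differential G u" if "u \<in> U" for u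
    unfolding G'_def
    using linear_differential[OF sG that] by (simp add: bounded_linear_Blinfun_apply linear_conv_bounded_linear)
  have cont: "continuous_on U G'"
  proof (rule continuous_on_blinfun_componentwise)
    fix i :: "real^'n" assume "i \<in> Basis"
    have "continuous_on U (\<lambda>u. differential G u i)"
      by (rule smooth_on_continuous_on[OF smooth_on_differential[OF sG]])
    then show "continuous_on U (\<lambda>u. blinfun_apply (G' u) i)"
      by (rule continuous_on_eq) (simp add: G')
  qed
  have "inj (differential G p)"
    using assms(4) unfolding dG[OF assms(3)] inj_def by (metis JK(3))
  then obtain I where I: "linear I" "I \<circ> differential G p = id"
    using linear_injective_left_inverse[OF linear_differential[OF sG assms(3)]] by blast
  have "Blinfun I o\<^sub>L G' p = id_blinfun"
    using I by (intro blinfun_eqI)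
      (simp add: G' assms(3) bounded_linear_Blinfun_apply linear_conv_bounded_linear pointfree_idE)
  then obtain U' V g g' where inv: "open U'" "U' \<subseteq> U" "p \<in> U'" "open V" "G p \<in> V" "homeomorphism U' V G g"
    "\<And>y. y \<in> V \<Longrightarrow> (g has_derivative (g' y)) (at y)"
    "\<And>y. y \<in> V \<Longrightarrow> g' y = inv (blinfun_apply (G' (g y)))"
    "\<And>y. y \<in> V \<Longrightarrow> bij (blinfun_apply (G' (g y)))"
    using inverse_function_theorem[of U G G' p "Blinfun I"] cont assms(1,3) G' smooth_on_has_derivative[OF sG]
    by (metis (no_types, lifting))
  have gV: "g ` V \<subseteq> U" using inv(2,6) by (auto simp: homeomorphism_def)
  have bij: "bij (differential G (g y))" "g' y = inv (differential G (g y))" if "y \<in> V" for y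
    using inv(8,9)[OF that] G'[of "g y"] gV that by auto
  have "smooth_on V g"
    unfolding smooth_on_def
  proof
    show "Ck_on k V g" for k
    proof (rule Ck_on_inverse_map[OF assms(1) inv(4) sG gV inv(7)])
      show "inj (differential G (g y))" if "y \<in> V" for y using bij[OF that] bij_is_inj by blast
      show "differential G (g y) (g' y v) = v" if "y \<in> V" for y v
        using bij[OF that] by (simp add: bij_is_surj surj_f_inv_f)
    qed
  qed
  define W' where "W' = J -` V"
  have oW': "open W'" unfolding W'_def
    by (intro open_vimage inv linear_continuous_on bJ)
  show thesis
  proof (rule that[OF inv(1,2,3) oW'])
    have "J ` W' = V" unfolding W'_def using surj_image_vimage_eq[OF surjI[of J K, OF JK(4)]] .
    then show "smooth_on W' (\<lambda>q. g (J q))"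
      by (intro smooth_on_compose[OF oW' inv(4) _ \<open>smooth_on V g\<close>] smooth_on_bounded_linear[OF oW' bJ] smooth_on_id oW') auto
    have cF: "continuous_on U' F"
      using smooth_on_continuous_on[OF assms(2)] inv(2) continuous_on_subset by blast
    have cg: "continuous_on W' (\<lambda>q. g (J q))"
      by (rule smooth_on_continuous_on) fact
    show "homeomorphism U' W' F (\<lambda>q. g (J q))"
    proof (rule homeomorphismI[OF cF cg])
      have GV: "G x \<in> V" "g (G x) = x" if "x \<in> U'" for x
        using inv(6) that unfolding homeomorphism_def by auto
      have gU: "g y \<in> U'" "G (g y) = y" if "y \<in> V" for y
        using inv(6) that unfolding homeomorphism_def by auto
      show "F ` U' \<subseteq> W'" using GV(1) unfolding G_def W'_def by auto
      show "(\<lambda>q. g (J q)) ` W' \<subseteq> U'" using gU(1) unfolding W'_def by auto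
      show "g (J (F x)) = x" if "x \<in> U'" for x using GV(2)[OF that] unfolding G_def .
      show "F (g (J q)) = q" if "q \<in> W'" for q
        using gU(2)[of "J q"] that unfolding G_def W'_def by (metis JK(3) vimageE)
    qed
  qed
qed

section \<open>The Lorentz product and null vectors\<close>

lemma bounded_bilinear_lorentz: "bounded_bilinear (lorentz :: real \<times> 'v::euclidean_space \<Rightarrow> _)"
  unfolding bilinear_conv_bounded_bilinear[symmetric] bilinear_def
  by (auto intro!: linearI simp: lorentz_def algebra_simps inner_add_left inner_add_right)

interpretation lorentz: bounded_bilinear lorentz
  by (rule bounded_bilinear_lorentz)

lemma lorentz_commute: "lorentz p q = lorentz q p"
  by (simp add: lorentz_def inner_commute)

lemmas smooth_on_lorentz = smooth_on_bounded_bilinear[OF _ bounded_bilinear_lorentz]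

text \<open>
  By dimension count: the image of \<open>D\<close> is positive definite, so it meets the line of the null vector
  \<open>\<theta>\<close> only in zero, and the two together fill the hyperplane orthogonal to \<open>\<theta>\<close>.
\<close>

lemma null_vector_complement:
  fixes D :: "'a::euclidean_space \<Rightarrow> real \<times> 'v::euclidean_space"
  assumes "linear D" and pos: "\<And>v. v \<noteq> 0 \<Longrightarrow> lorentz (D v) (D v) > 0"
    and "DIM('v) = DIM('a) + 1"
    and "\<theta> \<noteq> 0" "lorentz \<theta> \<theta> = 0" and perp: "\<And>v. lorentz (D v) \<theta> = 0"
    and "lorentz w \<theta> = 0"
  obtains v c where "w = D v + c *\<^sub>R \<theta>"
proof -
  interpret linear D by fact
  define L where "L p = D (fst p) + snd p *\<^sub>R \<theta>" for p :: "'a \<times> real"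
  \<comment> \<open>The Euclidean normal of the Lorentz-orthogonal hyperplane of \<open>\<theta>\<close>.\<close>
  define n where "n = (- fst \<theta>, snd \<theta>)"
  have n: "n \<noteq> 0" "lorentz q \<theta> = n \<bullet> q" for q
    using \<open>\<theta> \<noteq> 0\<close> by (auto simp: n_def lorentz_def prod_eq_iff inner_prod_def inner_commute mult.commute)
  have "linear L"
    unfolding L_def by (intro linearI) (auto simp: add scale algebra_simps)
  have "inj L"
    unfolding linear_injective_0[OF \<open>linear L\<close>]
  proof (intro allI impI)
    fix p assume p: "L p = 0"
    then have "D (fst p) = - (snd p *\<^sub>R \<theta>)" unfolding L_def by (simp add: eq_neg_iff_add_eq_0)
    then have "lorentz (D (fst p)) (D (fst p)) = - snd p * lorentz (D (fst p)) \<theta>"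
      by (metis lorentz.minus_right lorentz.scaleR_right mult_minus_left real_scaleR_def)
    then have "fst p = 0" using pos[of "fst p"] perp by force
    then have "snd p *\<^sub>R \<theta> = 0" using p by (simp add: L_def zero)
    then show "p = 0" using \<open>fst p = 0\<close> \<open>\<theta> \<noteq> 0\<close> by (metis prod.collapse scaleR_eq_0_iff zero_prod_def)
  qed
  have "dim (range L) = DIM('a \<times> real)"
    using dim_image_eq[OF \<open>linear L\<close>, of UNIV] \<open>inj L\<close> by simp
  moreover have "dim {q. n \<bullet> q = 0} = DIM(real \<times> 'v) - 1"
    by (rule dim_hyperplane[OF n(1)])
  moreover have sub: "range L \<subseteq> {q. n \<bullet> q = 0}"
    using perp assms(5) unfolding L_def n(2)[symmetric]
    by (auto simp: lorentz.add_left lorentz.scaleR_left)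
  ultimately have "range L = {q. n \<bullet> q = 0}"
    using assms(3) by (intro subspace_dim_equal subspace_hyperplane)
      (auto intro: linear_subspace_image[OF \<open>linear L\<close> subspace_UNIV])
  then have "w \<in> range L" using assms(7) n(2) by auto
  then show thesis using that unfolding L_def by auto
qed

section \<open>Tangent and normal projections of a space-like immersion\<close>

locale spacelike_patch =
  fixes U :: "(real^'n) set" and f :: "real^'n \<Rightarrow> real \<times> 'v::euclidean_space"
  assumes open_U: "open U" and immersion: "spacelike_immersion U f"
begin

lemma smooth_f: "smooth_on U f"
  using immersion by (simp add: spacelike_immersion_def)

lemma linear_df: "u \<in> U \<Longrightarrow> linear (differential f u)"
  by (rule linear_differential[OF smooth_f])

lemma df_pos: "u \<in> U \<Longrightarrow> v \<noteq> 0 \<Longrightarrow> lorentz (differential f u v) (differential f u v) > 0"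
  using immersion by (simp add: spacelike_immersion_def)

lemma normal_space_iff: "w \<in> normal_space f u \<longleftrightarrow> (\<forall>v. lorentz w (differential f u v) = 0)"
  by (auto simp: normal_space_def tangent_space_def)

lemma normal_space_add: "a \<in> normal_space f u \<Longrightarrow> b \<in> normal_space f u \<Longrightarrow> a + b \<in> normal_space f u"
  by (simp add: normal_space_iff lorentz.add_left)

lemma normal_space_scaleR: "a \<in> normal_space f u \<Longrightarrow> c *\<^sub>R a \<in> normal_space f u"
  by (simp add: normal_space_iff lorentz.scaleR_left)

lemma normal_space_diff: "a \<in> normal_space f u \<Longrightarrow> b \<in> normal_space f u \<Longrightarrow> a - b \<in> normal_space f u"
  by (simp add: normal_space_iff lorentz.diff_left)

text \<open>A linear map rather than a matrix, so that the results on linear systems apply as they stand.\<close>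

definition gram :: "real^'n \<Rightarrow> real^'n \<Rightarrow> real^'n" where
  "gram u v = (\<chi> i. lorentz (differential f u v) (differential f u (axis i 1)))"

definition tangent_coords :: "real^'n \<Rightarrow> real \<times> 'v \<Rightarrow> real^'n" where
  "tangent_coords u w = (SOME c. w - differential f u c \<in> normal_space f u)"

lemma linear_gram: "u \<in> U \<Longrightarrow> linear (gram u)"
proof -
  assume "u \<in> U"
  then interpret linear "differential f u" by (rule linear_df)
  show ?thesis
    by (intro linearI) (auto simp: gram_def vec_eq_iff add scale lorentz.add_left lorentz.scaleR_left)
qed

lemma normal_space_axesI:
  assumes "u \<in> U" "\<And>i. lorentz w (differential f u (axis i 1)) = 0"
  shows "w \<in> normal_space f u"
  unfolding normal_space_iff
proof
  fix v
  interpret linear "differential f u" using assms(1) by (rule linear_df)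
  have "differential f u v = differential f u (\<Sum>i\<in>UNIV. (v $ i) *\<^sub>R axis i 1)"
    using basis_expansion[of v] by (simp add: scalar_mult_eq_scaleR)
  then show "lorentz w (differential f u v) = 0"
    by (simp add: sum scale lorentz.sum_right lorentz.scaleR_right assms(2))
qed

lemma inj_gram: "u \<in> U \<Longrightarrow> inj (gram u)"
  unfolding linear_injective_0[OF linear_gram]
proof (intro allI impI)
  fix v assume u: "u \<in> U" and "gram u v = 0"
  then have "differential f u v \<in> normal_space f u"
    by (intro normal_space_axesI) (auto simp: gram_def vec_eq_iff)
  then show "v = 0" using df_pos[OF u] unfolding normal_space_iff by force
qed

text \<open>
  A vector is orthogonal to the tangent space once it is orthogonal to the coordinate vectors. The
  resulting linear system has the Gram matrix as coefficients, which is invertible because the induced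
  metric is definite.
\<close>

lemma tangent_coords:
  assumes "u \<in> U"
  shows "w - differential f u (tangent_coords u w) \<in> normal_space f u"
  unfolding tangent_coords_def
proof (rule someI_ex)
  have "surj (gram u)"
    using linear_injective_imp_surjective[OF linear_gram inj_gram] assms by blast
  then obtain c where c: "gram u c = (\<chi> i. lorentz w (differential f u (axis i 1)))"
    by (metis surjD)
  have "w - differential f u c \<in> normal_space f u"
    by (rule normal_space_axesI[OF assms]) (use c in \<open>auto simp: gram_def vec_eq_iff lorentz.diff_left\<close>)
  then show "\<exists>c. w - differential f u c \<in> normal_space f u" by blast
qed

lemma tangent_normal_unique:
  assumes "u \<in> U" "w - differential f u a \<in> normal_space f u" "w - differential f u b \<in> normal_space f u"
  shows "a = b"
proof -
  interpret linear "differential f u" using assms(1) by (rule linear_df)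
  have "differential f u (a - b) \<in> normal_space f u"
    using normal_space_diff[OF assms(3,2)] by (simp add: diff)
  then show ?thesis using df_pos[OF assms(1), of "a - b"] unfolding normal_space_iff by force
qed

lemma tangent_part_eq:
  assumes "u \<in> U"
  shows "tangent_part f u w = differential f u (tangent_coords u w)"
  unfolding tangent_part_def
proof (rule the_equality)
  show "differential f u (tangent_coords u w) \<in> tangent_space f u \<and>
      w - differential f u (tangent_coords u w) \<in> normal_space f u"
    using tangent_coords[OF assms] by (simp add: tangent_space_def)
  show "a = differential f u (tangent_coords u w)"
    if "a \<in> tangent_space f u \<and> w - a \<in> normal_space f u" for a
    using that tangent_normal_unique[OF assms _ tangent_coords[OF assms], of w]
    unfolding tangent_space_def by blast
qed

lemma normal_part_in: "u \<in> U \<Longrightarrow> normal_part f u w \<in> normal_space f u"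
  by (simp add: normal_part_def tangent_part_eq tangent_coords)

lemma normal_part_decomp:
  assumes "u \<in> U" "\<nu> \<in> normal_space f u"
  shows "normal_part f u (differential f u v + \<nu>) = \<nu>"
  using tangent_normal_unique[OF assms(1), of "differential f u v + \<nu>" v "tangent_coords u (differential f u v + \<nu>)"]
    tangent_coords[OF assms(1), of "differential f u v + \<nu>"] assms
  by (simp add: normal_part_def tangent_part_eq)

lemma normal_part_cases:
  assumes "u \<in> U"
  obtains v where "w = differential f u v + normal_part f u w"
  using that[of "tangent_coords u w"] by (simp add: normal_part_def tangent_part_eq assms)

lemma normal_part_tangent: "u \<in> U \<Longrightarrow> w \<in> tangent_space f u \<Longrightarrow> normal_part f u w = 0"
  using normal_part_decomp[of u 0] by (auto simp: tangent_space_def normal_space_iff lorentz.zero_left)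

lemma normal_part_normal: "u \<in> U \<Longrightarrow> w \<in> normal_space f u \<Longrightarrow> normal_part f u w = w"
  using normal_part_decomp[of u w 0] linear_0[OF linear_df] by simp

lemma linear_normal_part: "u \<in> U \<Longrightarrow> linear (normal_part f u)"
proof (rule linearI)
  assume u: "u \<in> U"
  interpret linear "differential f u" using u by (rule linear_df)
  show "normal_part f u (a + b) = normal_part f u a + normal_part f u b" for a b
  proof -
    obtain v w where v: "a = differential f u v + normal_part f u a"
      and w: "b = differential f u w + normal_part f u b"
      using normal_part_cases[OF u] by metis
    have "a + b = differential f u (v + w) + (normal_part f u a + normal_part f u b)"
      by (subst v, subst w) (simp add: add)
    then show ?thesis
      using normal_part_decomp[OF u normal_space_add[OF normal_part_in normal_part_in]] u by metis
  qed
  show "normal_part f u (r *\<^sub>R a) = r *\<^sub>R normal_part f u a" for r a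
  proof -
    obtain v where v: "a = differential f u v + normal_part f u a"
      using normal_part_cases[OF u] by metis
    have "r *\<^sub>R a = differential f u (r *\<^sub>R v) + r *\<^sub>R normal_part f u a"
      by (subst v) (simp add: scale scaleR_right_distrib)
    then show ?thesis
      using normal_part_decomp[OF u normal_space_scaleR[OF normal_part_in]] u by metis
  qed
qed

lemma lorentz_normal_part:
  assumes "u \<in> U" "\<nu> \<in> normal_space f u"
  shows "lorentz (normal_part f u w) \<nu> = lorentz w \<nu>"
proof -
  obtain v where "w = differential f u v + normal_part f u w" using normal_part_cases[OF assms(1)] .
  then have "lorentz w \<nu> = lorentz (differential f u v) \<nu> + lorentz (normal_part f u w) \<nu>"
    by (metis lorentz.add_left)
  then show ?thesis using assms(2) by (simp add: normal_space_iff lorentz_commute)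
qed

lemma smooth_tangent_coords:
  assumes "smooth_on U w"
  shows "smooth_on U (\<lambda>u. tangent_coords u (w u))"
proof (rule smooth_on_linear_solve[OF open_U linear_gram inj_gram])
  have comp: "smooth_on U (\<lambda>u. \<chi> i. lorentz (g u) (differential f u (axis i 1)))"
    if "smooth_on U g" for g :: "real^'n \<Rightarrow> real \<times> 'v"
  proof -
    have "smooth_on U (\<lambda>u. \<Sum>i\<in>UNIV. lorentz (g u) (differential f u (axis i 1)) *\<^sub>R (axis i 1 :: real^'n))"
      by (intro smooth_on_sum smooth_on_scaleR smooth_on_lorentz open_U that smooth_on_differential[OF smooth_f] smooth_on_const)
    moreover have "(\<Sum>i\<in>UNIV. c i *\<^sub>R (axis i 1 :: real^'n)) = (\<chi> i. c i)" for c
      using basis_expansion[of "\<chi> i. c i"] by (simp add: scalar_mult_eq_scaleR)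
    ultimately show ?thesis by simp
  qed
  show "smooth_on U (\<lambda>u. gram u v)" for v
    unfolding gram_def by (intro comp smooth_on_differential smooth_f)
  show "smooth_on U (\<lambda>u. \<chi> i. lorentz (w u) (differential f u (axis i 1)))"
    by (intro comp assms)
  show "gram u (tangent_coords u (w u)) = (\<chi> i. lorentz (w u) (differential f u (axis i 1)))"
    if "u \<in> U" for u
    using tangent_coords[OF that, of "w u"]
    by (simp add: gram_def vec_eq_iff normal_space_iff lorentz.diff_left)
qed

text \<open>
  Both parts of a smooth field are smooth since its tangential coordinates solve a linear system with
  smooth coefficients.
\<close>

lemma smooth_normal_part:
  assumes "smooth_on U w"
  shows "smooth_on U (\<lambda>u. normal_part f u (w u))"
proof (rule smooth_on_cong[OF open_U])
  show "smooth_on U (\<lambda>u. w u - differential f u (tangent_coords u (w u)))"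
    by (intro smooth_on_diff open_U assms smooth_on_differential_field smooth_f smooth_tangent_coords)
qed (simp add: normal_part_def tangent_part_eq)

text \<open>
  In the Lorentzian normal plane a null line is its own orthogonal complement.
\<close>

lemma normal_null_span:
  assumes "DIM('v) = CARD('n) + 1" "u \<in> U" "\<theta> \<in> normal_space f u" "\<theta> \<noteq> 0" "lorentz \<theta> \<theta> = 0"
    "w \<in> normal_space f u" "lorentz w \<theta> = 0"
  obtains c where "w = c *\<^sub>R \<theta>"
proof -
  have "DIM('v) = DIM(real^'n) + 1" using assms(1) by simp
  moreover have "lorentz (differential f u v) \<theta> = 0" for v
    using assms(3) by (metis lorentz_commute normal_space_iff)
  ultimately obtain v c where w: "w = differential f u v + c *\<^sub>R \<theta>"
    using null_vector_complement[OF linear_df[OF assms(2)] df_pos[OF assms(2)], of \<theta> w] assms by metis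
  have "w = c *\<^sub>R \<theta>"
    using normal_part_decomp[OF assms(2) normal_space_scaleR[OF assms(3)], of v c]
      normal_part_normal[OF assms(2,6)] w by metis
  then show thesis by (rule that)
qed

end

section \<open>Parallel normal frames\<close>

lemma differential_of_directional_derivative:
  assumes "open U" "smooth_on U a" "smooth_on U Y" "u \<in> U"
  shows "differential (\<lambda>x. differential a x (Y x)) u w
    = differential (\<lambda>x. differential a x (Y u)) u w + differential a u (differential Y u w)"
proof -
  let ?g = "\<lambda>x. \<Sum>b\<in>Basis. (Y x \<bullet> b) *\<^sub>R differential a x b"
  have lin: "(\<Sum>b\<in>Basis. (v \<bullet> b) *\<^sub>R differential a x b) = differential a x v" if "x \<in> U" for x v
  proof -
    interpret linear "differential a x" using linear_differential[OF assms(2) that] .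
    show ?thesis
      using sum[of "\<lambda>b. (v \<bullet> b) *\<^sub>R b" Basis] unfolding scale euclidean_representation ..
  qed
  have db: "((\<lambda>x. differential a x b) has_derivative differential (\<lambda>x. differential a x b) u) (at u)" for b
    by (rule smooth_on_has_derivative[OF smooth_on_differential[OF assms(2)] assms(4)])
  have dY: "((\<lambda>x. Y x \<bullet> b) has_derivative (\<lambda>v. differential Y u v \<bullet> b)) (at u)" for b
    by (rule bounded_linear.has_derivative[OF bounded_linear_inner_left smooth_on_has_derivative[OF assms(3,4)]])
  have "(?g has_derivative (\<lambda>v. \<Sum>b\<in>Basis. (Y u \<bullet> b) *\<^sub>R differential (\<lambda>x. differential a x b) u v
      + (differential Y u v \<bullet> b) *\<^sub>R differential a u b)) (at u)"
    by (intro has_derivative_sum has_derivative_scaleR dY db)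
  then have 1: "differential ?g u w = (\<Sum>b\<in>Basis. (Y u \<bullet> b) *\<^sub>R differential (\<lambda>x. differential a x b) u w)
      + differential a u (differential Y u w)"
    by (simp add: differential_eq sum.distrib lin assms(4))
  have "((\<lambda>x. \<Sum>b\<in>Basis. (Y u \<bullet> b) *\<^sub>R differential a x b) has_derivative
      (\<lambda>v. \<Sum>b\<in>Basis. (Y u \<bullet> b) *\<^sub>R differential (\<lambda>x. differential a x b) u v)) (at u)"
    by (intro has_derivative_sum has_derivative_scaleR_right db)
  then have 2: "differential (\<lambda>x. \<Sum>b\<in>Basis. (Y u \<bullet> b) *\<^sub>R differential a x b) u w
      = (\<Sum>b\<in>Basis. (Y u \<bullet> b) *\<^sub>R differential (\<lambda>x. differential a x b) u w)"
    by (simp add: differential_eq)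
  have "differential (\<lambda>x. differential a x (Y x)) u = differential ?g u"
    by (rule differential_cong[OF assms(1,4)]) (simp add: lin)
  moreover have "differential (\<lambda>x. differential a x (Y u)) u
      = differential (\<lambda>x. \<Sum>b\<in>Basis. (Y u \<bullet> b) *\<^sub>R differential a x b) u"
    by (rule differential_cong[OF assms(1,4)]) (simp add: lin)
  ultimately show ?thesis using 1 2 by simp
qed

text \<open>
  The second order terms cancel by the symmetry of second derivatives.
\<close>

lemma lie_bracket_commutator:
  assumes "open U" "smooth_on U a" "smooth_on U X" "smooth_on U Y" "u \<in> U"
  shows "differential (\<lambda>x. differential a x (Y x)) u (X u) - differential (\<lambda>x. differential a x (X x)) u (Y u)
    = differential a u (lie_bracket X Y u)"
  using differential_of_directional_derivative[OF assms(1,2,3,5)] differential_of_directional_derivative[OF assms(1,2,4,5)]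
    symmetric_second_differential[OF assms(1,2,5)] linear_differential[OF assms(2,5)]
  by (simp add: lie_bracket_def linear_diff)

context spacelike_patch
begin

text \<open>
  The field \<open>\<zeta>\<close> is completed by a second null field \<open>\<eta>\<close> with \<open>\<langle>\<zeta>, \<eta>\<rangle> = 1\<close> to a frame of the normal plane.
  Differentiating the constant products \<open>\<langle>\<eta>, \<zeta>\<rangle>\<close> and \<open>\<langle>\<eta>, \<eta>\<rangle>\<close> shows that \<open>\<eta>\<close> is parallel too. Normal derivatives
  then act on the two coefficients as plain directional derivatives, and these commute up to the bracket.
\<close>

lemma flat_if_parallel_null_field:
  assumes dim: "DIM('v) = CARD('n) + 1"
    and \<zeta>: "smooth_on U \<zeta>" "\<And>u. u \<in> U \<Longrightarrow> \<zeta> u \<in> normal_space f u" "\<And>u. u \<in> U \<Longrightarrow> lorentz (\<zeta> u) (\<zeta> u) = 0"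
      "\<And>u. u \<in> U \<Longrightarrow> fst (\<zeta> u) \<noteq> 0"
    and par: "\<And>u v. u \<in> U \<Longrightarrow> differential \<zeta> u v \<in> tangent_space f u"
    and XY: "smooth_on U X" "smooth_on U Y" and \<xi>: "normal_field f U \<xi>" and "u \<in> U"
  shows "normal_curvature f X Y \<xi> u = 0"
proof -
  have nz: "\<zeta> u \<noteq> 0" if "u \<in> U" for u using \<zeta>(4)[OF that] by force
  \<comment> \<open>The product of the time direction with \<open>\<zeta>\<close> is \<open>- fst \<zeta>\<close>, so its normal part is not orthogonal to \<open>\<zeta>\<close>.\<close>
  define \<nu> where "\<nu> u = normal_part f u (1, 0)" for u
  define m where "m u = lorentz (\<nu> u) (\<zeta> u)" for u
  \<comment> \<open>Scaled to have product one with \<open>\<zeta>\<close>, and made null by subtracting a multiple of \<open>\<zeta>\<close>.\<close>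
  define \<eta> where "\<eta> u = inverse (m u) *\<^sub>R \<nu> u
    - (lorentz (\<nu> u) (\<nu> u) * (inverse (m u) * inverse (m u)) * (1/2)) *\<^sub>R \<zeta> u" for u
  have m: "m u \<noteq> 0" if "u \<in> U" for u
    using \<zeta>(4)[OF that] unfolding m_def \<nu>_def lorentz_normal_part[OF that \<zeta>(2)[OF that]]
    by (simp add: lorentz_def)
  have s\<nu>: "smooth_on U \<nu>" unfolding \<nu>_def[abs_def] by (intro smooth_normal_part smooth_on_const open_U)
  have sm: "smooth_on U (\<lambda>u. inverse (m u))"
    using m unfolding m_def by (intro smooth_on_inverse smooth_on_lorentz s\<nu> \<zeta>(1) open_U) auto
  have s\<eta>: "smooth_on U \<eta>"
    unfolding \<eta>_def[abs_def]
    by (intro smooth_on_diff smooth_on_scaleR smooth_on_mult smooth_on_lorentz s\<nu> sm \<zeta>(1) open_U smooth_on_const)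
  have \<eta>n: "\<eta> u \<in> normal_space f u" if "u \<in> U" for u
    unfolding \<eta>_def \<nu>_def using that \<zeta>(2)
    by (intro normal_space_diff normal_space_scaleR normal_part_in) auto
  have \<eta>\<zeta>: "lorentz (\<eta> u) (\<zeta> u) = 1" if "u \<in> U" for u
    using m[OF that] \<zeta>(3)[OF that]
    by (simp add: \<eta>_def lorentz.diff_left lorentz.scaleR_left m_def[symmetric])
  have \<eta>\<eta>: "lorentz (\<eta> u) (\<eta> u) = 0" if "u \<in> U" for u
  proof -
    have "lorentz (\<zeta> u) (\<nu> u) = m u" unfolding m_def by (rule lorentz_commute)
    then show ?thesis
      using m[OF that] \<zeta>(3)[OF that]
      by (simp add: \<eta>_def lorentz.diff_left lorentz.scaleR_left lorentz.diff_right lorentz.scaleR_right m_def[symmetric] field_simps)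
  qed
  have span: "w = 0" if w: "u \<in> U" "w \<in> normal_space f u" "lorentz w (\<zeta> u) = 0" "lorentz w (\<eta> u) = 0" for u w
  proof -
    obtain c where c: "w = c *\<^sub>R \<zeta> u"
      by (rule normal_null_span[OF dim w(1) \<zeta>(2)[OF w(1)] nz[OF w(1)] \<zeta>(3)[OF w(1)] w(2,3)])
    have "c = 0" using that(4) \<eta>\<zeta>[OF that(1)] unfolding c
      by (simp add: lorentz.scaleR_left lorentz_commute[of "\<zeta> u"])
    then show ?thesis using c by simp
  qed
  have dl: "lorentz (differential p u v) (q u) + lorentz (p u) (differential q u v) = 0"
    if "u \<in> U" "smooth_on U p" "smooth_on U q" "\<And>u. u \<in> U \<Longrightarrow> lorentz (p u) (q u) = c" for p q u v c
  proof -
    have "((\<lambda>x. lorentz (p x) (q x)) has_derivative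
        (\<lambda>v. lorentz (p u) (differential q u v) + lorentz (differential p u v) (q u))) (at u)"
      by (rule lorentz.FDERIV[OF smooth_on_has_derivative[OF that(2,1)] smooth_on_has_derivative[OF that(3,1)]])
    moreover have "differential (\<lambda>x. lorentz (p x) (q x)) u = differential (\<lambda>x. c) u"
      by (rule differential_cong[OF open_U that(1)]) (rule that(4))
    ultimately show ?thesis by (simp add: differential_eq fun_eq_iff add.commute)
  qed
  have par\<zeta>: "normal_part f u (differential \<zeta> u v) = 0" if "u \<in> U" for u v
    using normal_part_tangent[OF that par[OF that]] .
  have par\<eta>: "normal_part f u (differential \<eta> u v) = 0" if "u \<in> U" for u v
  proof (rule span[OF that normal_part_in[OF that]])
    have "lorentz (\<eta> u) (differential \<zeta> u v) = 0"
      using par[OF that] \<eta>n[OF that] by (auto simp: normal_space_def)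
    then show "lorentz (normal_part f u (differential \<eta> u v)) (\<zeta> u) = 0"
      unfolding lorentz_normal_part[OF that \<zeta>(2)[OF that]]
      using dl[OF that s\<eta> \<zeta>(1) \<eta>\<zeta>, of v] by simp
    show "lorentz (normal_part f u (differential \<eta> u v)) (\<eta> u) = 0"
      unfolding lorentz_normal_part[OF that \<eta>n[OF that]]
      using dl[OF that s\<eta> s\<eta> \<eta>\<eta>, of v] by (simp add: lorentz_commute)
  qed
  have conn: "normal_connection f Z g u = differential a u (Z u) *\<^sub>R \<zeta> u + differential b u (Z u) *\<^sub>R \<eta> u"
    if u: "u \<in> U" and ab: "smooth_on U a" "smooth_on U b" and g: "\<And>x. x \<in> U \<Longrightarrow> g x = a x *\<^sub>R \<zeta> x + b x *\<^sub>R \<eta> x"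
    for Z g a b u
  proof -
    have "((\<lambda>x. a x *\<^sub>R \<zeta> x + b x *\<^sub>R \<eta> x) has_derivative
      (\<lambda>v. (a u *\<^sub>R differential \<zeta> u v + differential a u v *\<^sub>R \<zeta> u) + (b u *\<^sub>R differential \<eta> u v + differential b u v *\<^sub>R \<eta> u))) (at u)"
      by (intro has_derivative_add has_derivative_scaleR smooth_on_has_derivative[OF _ u] ab \<zeta>(1) s\<eta>)
    moreover have "differential g u = differential (\<lambda>x. a x *\<^sub>R \<zeta> x + b x *\<^sub>R \<eta> x) u"
      by (rule differential_cong[OF open_U u g])
    ultimately have dg: "differential g u v = (a u *\<^sub>R differential \<zeta> u v + differential a u v *\<^sub>R \<zeta> u) + (b u *\<^sub>R differential \<eta> u v + differential b u v *\<^sub>R \<eta> u)" for v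
      by (simp add: differential_eq)
    interpret N: linear "normal_part f u" using linear_normal_part[OF u] .
    show ?thesis
      unfolding normal_connection_def dg N.add N.scale par\<zeta>[OF u] par\<eta>[OF u]
        normal_part_normal[OF u \<zeta>(2)[OF u]] normal_part_normal[OF u \<eta>n[OF u]] by simp
  qed
  define a where "a u = lorentz (\<xi> u) (\<eta> u)" for u
  define b where "b u = lorentz (\<xi> u) (\<zeta> u)" for u
  have s\<xi>: "smooth_on U \<xi>" and \<xi>n: "\<And>u. u \<in> U \<Longrightarrow> \<xi> u \<in> normal_space f u"
    using \<xi> by (auto simp: normal_field_def)
  have sa: "smooth_on U a" and sb: "smooth_on U b"
    unfolding a_def[abs_def] b_def[abs_def] by (intro smooth_on_lorentz open_U s\<xi> s\<eta> \<zeta>(1))+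
  have \<xi>ab: "\<xi> x = a x *\<^sub>R \<zeta> x + b x *\<^sub>R \<eta> x" if "x \<in> U" for x
  proof -
    have "\<xi> x - (a x *\<^sub>R \<zeta> x + b x *\<^sub>R \<eta> x) = 0"
      using \<eta>\<zeta>[OF that] \<zeta>(3)[OF that] \<eta>\<eta>[OF that] lorentz_commute[of "\<zeta> x" "\<eta> x"]
      by (intro span[OF that] normal_space_diff normal_space_add normal_space_scaleR \<xi>n \<zeta>(2) \<eta>n that)
        (simp_all add: lorentz.diff_left lorentz.add_left lorentz.scaleR_left a_def b_def)
    then show ?thesis by simp
  qed
  have conn1: "normal_connection f Z \<xi> x = differential a x (Z x) *\<^sub>R \<zeta> x + differential b x (Z x) *\<^sub>R \<eta> x"
    if "x \<in> U" for Z x using conn[OF that sa sb \<xi>ab] .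
  have conn2: "normal_connection f Z (normal_connection f Z' \<xi>) u
     = differential (\<lambda>x. differential a x (Z' x)) u (Z u) *\<^sub>R \<zeta> u + differential (\<lambda>x. differential b x (Z' x)) u (Z u) *\<^sub>R \<eta> u"
    if "smooth_on U Z'" for Z Z'
    by (intro conn[OF \<open>u \<in> U\<close> _ _ conn1] smooth_on_differential_field open_U sa sb that)
  show ?thesis
    unfolding normal_curvature_def conn1[OF \<open>u \<in> U\<close>] conn2[OF XY(1)] conn2[OF XY(2)]
      lie_bracket_commutator[OF open_U sa XY \<open>u \<in> U\<close>, symmetric]
      lie_bracket_commutator[OF open_U sb XY \<open>u \<in> U\<close>, symmetric]
    by (simp add: algebra_simps)
qed

end

section \<open>Immersions into the cylinder over the light cone\<close>

lemma theta_eq: "theta p = (fst p, fst (snd p), 0)"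
  by (simp add: theta_def case_prod_unfold)

lemma bounded_linear_theta: "bounded_linear theta"
  unfolding theta_eq[abs_def]
  by (intro bounded_linear_Pair bounded_linear_fst bounded_linear_zero
      bounded_linear_compose[OF bounded_linear_fst bounded_linear_snd])

lemma bounded_linear_height: "bounded_linear (\<lambda>p. snd (snd p) :: real)"
  by (rule bounded_linear_compose[OF bounded_linear_snd bounded_linear_snd])

text \<open>
  Applied to derivatives of the position vector: those of \<open>\<theta>\<close> are tangent up to a multiple of \<open>\<partial>\<^sub>z\<close>.
\<close>

lemma theta_plus_height: "p = theta p + snd (snd p) *\<^sub>R (0, 0, 1)"
  by (simp add: theta_eq prod_eq_iff)

lemma lorentz_theta: "lorentz p (theta q) = lorentz (theta p) (theta q)"
  by (cases p; cases q) (simp add: theta_eq lorentz_def)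

lemma theta_0: "theta 0 = 0"
  by (simp add: theta_eq zero_prod_def)

locale cylinder_patch = spacelike_patch U f
  for U :: "(real^'n) set" and f :: "real^'n \<Rightarrow> real \<times> (real^'n) \<times> real" +
  assumes on_cylinder: "f ` U \<subseteq> light_cone_cylinder"
begin

abbreviation \<theta> :: "real^'n \<Rightarrow> real \<times> (real^'n) \<times> real" where
  "\<theta> \<equiv> \<lambda>u. theta (f u)"

abbreviation dz :: "real^'n \<Rightarrow> real^'n \<Rightarrow> real" where
  "dz u v \<equiv> snd (snd (differential f u v))"

text \<open>Taken from the projection of \<open>\<partial>\<^sub>z\<close>, so that it inherits the smoothness of the projection.\<close>

definition e1_coords :: "real^'n \<Rightarrow> real^'n" where
  "e1_coords u = tangent_coords u (0, 0, 1)"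

text \<open>The function \<open>\<alpha>\<close>, read off from the first component of \<open>\<partial>\<^sub>z = e\<^sub>1 - \<alpha> \<theta>\<close>.\<close>

definition alpha_coeff :: "real^'n \<Rightarrow> real" where
  "alpha_coeff u = fst (differential f u (e1_coords u)) * inverse (fst (f u))"

lemma fst_pos: "u \<in> U \<Longrightarrow> fst (f u) > 0"
  using on_cylinder by (fastforce simp: light_cone_cylinder_def light_cone_def)

lemma theta_null: "u \<in> U \<Longrightarrow> lorentz (\<theta> u) (\<theta> u) = 0"
  using on_cylinder by (fastforce simp: light_cone_cylinder_def light_cone_def lorentz_def theta_eq)

lemma theta_nz: "u \<in> U \<Longrightarrow> \<theta> u \<noteq> 0"
  using fst_pos by (force simp: theta_eq prod_eq_iff)

lemma smooth_theta: "smooth_on U \<theta>"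
  by (rule smooth_on_bounded_linear[OF open_U bounded_linear_theta smooth_f])

lemma theta_has_derivative: "u \<in> U \<Longrightarrow> (\<theta> has_derivative (\<lambda>v. theta (differential f u v))) (at u)"
  by (rule bounded_linear.has_derivative[OF bounded_linear_theta smooth_on_has_derivative[OF smooth_f]])

text \<open>
  Differentiating \<open>\<langle>\<theta>, \<theta>\<rangle> = 0\<close> shows that \<open>\<theta>\<close> is orthogonal to its own derivatives; these differ from
  tangent vectors only in the last coordinate, which pairs to zero with \<open>\<theta>\<close>.
\<close>

lemma theta_normal: "u \<in> U \<Longrightarrow> \<theta> u \<in> normal_space f u"
proof (unfold normal_space_iff, intro allI)
  fix v assume u: "u \<in> U"
  have "((\<lambda>x. lorentz (\<theta> x) (\<theta> x)) has_derivative
      (\<lambda>v. lorentz (\<theta> u) (theta (differential f u v)) + lorentz (theta (differential f u v)) (\<theta> u))) (at u)"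
    by (intro lorentz.FDERIV theta_has_derivative u)
  moreover have "differential (\<lambda>x. lorentz (\<theta> x) (\<theta> x)) u = differential (\<lambda>x. 0) u"
    by (rule differential_cong[OF open_U u]) (simp add: theta_null)
  ultimately have "lorentz (\<theta> u) (theta (differential f u v)) + lorentz (theta (differential f u v)) (\<theta> u) = 0"
    by (simp add: differential_eq fun_eq_iff)
  then show "lorentz (\<theta> u) (differential f u v) = 0"
    using lorentz_commute[of "\<theta> u" "theta (differential f u v)"]
      lorentz_theta[of "differential f u v" "f u"] lorentz_commute[of "\<theta> u" "differential f u v"] by linarith
qed

lemma df_e1: "u \<in> U \<Longrightarrow> differential f u (e1_coords u) = (0, 0, 1) + alpha_coeff u *\<^sub>R \<theta> u"
proof -
  assume u: "u \<in> U"
  define \<nu> where "\<nu> = (0, 0, 1) - differential f u (e1_coords u)"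
  have \<nu>: "\<nu> \<in> normal_space f u"
    unfolding \<nu>_def e1_coords_def by (rule tangent_coords[OF u])
  have "lorentz (differential f u (e1_coords u)) (\<theta> u) = 0"
    using theta_normal[OF u] by (metis lorentz_commute normal_space_iff)
  then have "lorentz \<nu> (\<theta> u) = 0"
    unfolding \<nu>_def lorentz.diff_left by (simp add: lorentz_def theta_eq)
  moreover have "DIM((real^'n) \<times> real) = CARD('n) + 1" by simp
  ultimately obtain c where c: "\<nu> = c *\<^sub>R \<theta> u"
    using normal_null_span[OF _ u theta_normal[OF u] theta_nz[OF u] theta_null[OF u] \<nu>] by blast
  then have d: "differential f u (e1_coords u) = (0, 0, 1) + (- c) *\<^sub>R \<theta> u"
    unfolding \<nu>_def by (simp add: algebra_simps)
  then have "alpha_coeff u = - c" unfolding alpha_coeff_def using fst_pos[OF u] by (simp add: theta_eq)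
  then show ?thesis using d by simp
qed

lemma dz_e1: "u \<in> U \<Longrightarrow> dz u (e1_coords u) = 1"
  by (simp add: df_e1 theta_eq)

lemma theta_df_e1: "u \<in> U \<Longrightarrow> theta (differential f u (e1_coords u)) = alpha_coeff u *\<^sub>R \<theta> u"
  by (simp add: df_e1 theta_eq)

lemma smooth_e1_coords: "smooth_on U e1_coords"
  unfolding e1_coords_def[abs_def] by (intro smooth_tangent_coords smooth_on_const open_U)

lemma smooth_alpha_coeff: "smooth_on U alpha_coeff"
  unfolding alpha_coeff_def[abs_def]
  using fst_pos by (intro smooth_on_mult smooth_on_fst smooth_on_differential_field smooth_e1_coords smooth_f
      smooth_on_inverse open_U) force+

text \<open>
  The normal part of \<open>\<partial>\<^sub>z\<close> is \<open>- \<alpha> \<theta>\<close>. Hence \<open>\<alpha> dz\<close> is the connection form of \<open>\<theta>\<close>.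
\<close>

lemma normal_part_theta_df:
  assumes "u \<in> U"
  shows "normal_part f u (theta (differential f u v)) = (alpha_coeff u * dz u v) *\<^sub>R \<theta> u"
proof -
  interpret linear "differential f u" by (rule linear_df[OF assms])
  have "theta (differential f u v) = differential f u v - dz u v *\<^sub>R (0, 0, 1)"
    using theta_plus_height[of "differential f u v"] by (simp add: eq_diff_eq)
  also have "(0, 0, 1) = differential f u (e1_coords u) - alpha_coeff u *\<^sub>R \<theta> u"
    using df_e1[OF assms] by (simp add: eq_diff_eq)
  finally have "theta (differential f u v)
      = differential f u (v - dz u v *\<^sub>R e1_coords u) + (alpha_coeff u * dz u v) *\<^sub>R \<theta> u"
    by (simp add: diff scale algebra_simps)
  then show ?thesis
    using normal_part_decomp[OF assms normal_space_scaleR[OF theta_normal[OF assms]]] by simp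
qed

text \<open>
  The curvature of \<open>\<theta>\<close> is \<open>(d\<alpha> \<and> dz) \<theta>\<close>. If it vanishes, inserting \<open>e\<^sub>1\<close>, on which \<open>dz\<close> is one, gives
  \<open>d\<alpha> = d\<alpha>(e\<^sub>1) dz\<close>. Constant coordinate fields suffice, and their bracket is zero.
\<close>

lemma alpha_coeff_constant_on_slices:
  assumes u: "u \<in> U"
    and flat: "\<And>v w. normal_curvature f (\<lambda>_. v) (\<lambda>_. w) \<theta> u = 0"
    and "dz u v = 0"
  shows "differential alpha_coeff u v = 0"
proof -
  define z where "z x = snd (snd (f x))" for x
  have sz: "smooth_on U z" unfolding z_def[abs_def]
    by (rule smooth_on_bounded_linear[OF open_U bounded_linear_height smooth_f])
  have z: "differential z x = dz x" if "x \<in> U" for x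
    unfolding z_def[abs_def]
    by (intro differential_eq bounded_linear.has_derivative[OF bounded_linear_height smooth_on_has_derivative[OF smooth_f that]])
  have s: "smooth_on U (\<lambda>x. alpha_coeff x * differential z x w)" for w
    by (intro smooth_on_mult smooth_alpha_coeff smooth_on_differential sz open_U)
  have conn: "normal_connection f (\<lambda>_. w) \<theta> x = (alpha_coeff x * differential z x w) *\<^sub>R \<theta> x" if "x \<in> U" for x w
    unfolding normal_connection_def
    by (simp add: differential_eq[OF theta_has_derivative[OF that]] normal_part_theta_df[OF that] z[OF that])
  have conn2: "normal_connection f (\<lambda>_. v) (normal_connection f (\<lambda>_. w) \<theta>) u
      = (differential (\<lambda>x. alpha_coeff x * differential z x w) u v + (alpha_coeff u * dz u w) * (alpha_coeff u * dz u v)) *\<^sub>R \<theta> u" for v w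
  proof -
    let ?g = "\<lambda>x. alpha_coeff x * differential z x w"
    interpret N: linear "normal_part f u" using linear_normal_part[OF u] .
    have "((\<lambda>x. ?g x *\<^sub>R \<theta> x) has_derivative
       (\<lambda>v. ?g u *\<^sub>R theta (differential f u v) + differential ?g u v *\<^sub>R \<theta> u)) (at u)"
      by (intro has_derivative_scaleR theta_has_derivative u smooth_on_has_derivative[OF s u])
    moreover have "differential (normal_connection f (\<lambda>_. w) \<theta>) u = differential (\<lambda>x. ?g x *\<^sub>R \<theta> x) u"
      by (rule differential_cong[OF open_U u conn])
    ultimately have "differential (normal_connection f (\<lambda>_. w) \<theta>) u v
        = ?g u *\<^sub>R theta (differential f u v) + differential ?g u v *\<^sub>R \<theta> u"
      by (simp add: differential_eq)
    then show ?thesis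
      unfolding normal_connection_def[of f "\<lambda>_. v"]
      by (simp add: N.add N.scale normal_part_theta_df[OF u] normal_part_normal[OF u theta_normal[OF u]] z[OF u] algebra_simps)
  qed
  have bracket: "normal_connection f (lie_bracket (\<lambda>_. v) (\<lambda>_. w)) \<theta> u = 0" for v w
    using linear_0[OF linear_normal_part[OF u]] linear_0[OF linear_df[OF u]]
    by (simp add: theta_0 normal_connection_def lie_bracket_def differential_eq[OF theta_has_derivative[OF u]])
  have d: "differential (\<lambda>x. alpha_coeff x * differential z x w) u v
      = alpha_coeff u * differential (\<lambda>x. differential z x w) u v + differential alpha_coeff u v * dz u w" for v w
  proof -
    have "((\<lambda>x. alpha_coeff x * differential z x w) has_derivative
        (\<lambda>h. alpha_coeff u * differential (\<lambda>x. differential z x w) u h + differential alpha_coeff u h * differential z u w)) (at u)"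
      by (rule has_derivative_mult[OF smooth_on_has_derivative[OF smooth_alpha_coeff u]
            smooth_on_has_derivative[OF smooth_on_differential[OF sz] u]])
    then show ?thesis by (simp add: differential_eq z[OF u])
  qed
  have "differential alpha_coeff u v * dz u w = differential alpha_coeff u w * dz u v" for v w
  proof -
    have sym: "differential (\<lambda>x. differential z x w) u v = differential (\<lambda>x. differential z x v) u w"
      by (rule symmetric_second_differential[OF open_U sz u])
    have "(alpha_coeff u * differential (\<lambda>x. differential z x v) u w + differential alpha_coeff u v * dz u w + alpha_coeff u * dz u w * (alpha_coeff u * dz u v)) *\<^sub>R \<theta> u
      - (alpha_coeff u * differential (\<lambda>x. differential z x v) u w + differential alpha_coeff u w * dz u v + alpha_coeff u * dz u v * (alpha_coeff u * dz u w)) *\<^sub>R \<theta> u - 0 = 0"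
      using flat[of v w] unfolding normal_curvature_def conn2 bracket d sym .
    then have "alpha_coeff u * differential (\<lambda>x. differential z x v) u w + differential alpha_coeff u v * dz u w + alpha_coeff u * dz u w * (alpha_coeff u * dz u v)
      = alpha_coeff u * differential (\<lambda>x. differential z x v) u w + differential alpha_coeff u w * dz u v + alpha_coeff u * dz u v * (alpha_coeff u * dz u w)"
      using theta_nz[OF u] by (metis diff_zero eq_iff_diff_eq_0 scaleR_right_imp_eq)
    then show ?thesis by (simp add: mult.commute mult.left_commute)
  qed
  from this[of v "e1_coords u"] show ?thesis using assms(3) dz_e1[OF u] by simp
qed

text \<open>
  The map \<open>F\<close> consists of \<open>z\<close> and a linear image \<open>L g\<close> of \<open>g = y / x\<^sub>1\<close>. A vector in the kernel of \<open>dz\<close> and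
  \<open>dg\<close> would be mapped to a multiple of the null vector \<open>\<theta>\<close> and is therefore zero; hence \<open>dg\<close> is injective
  on the kernel of \<open>dz\<close>, and \<open>L\<close> is chosen to identify the image of that kernel with the parameter space.
  As \<open>\<theta>\<close> is only rescaled along \<open>e\<^sub>1\<close>, the derivative of \<open>g\<close> in this direction vanishes.
\<close>

lemma adapted_coordinates:
  assumes p: "p \<in> U" and k: "CARD('n) = CARD('k::finite) + 1"
  obtains W W' and F :: "real^'n \<Rightarrow> real \<times> (real^'k)" and H
  where "open W" "W \<subseteq> U" "p \<in> W" "open W'" "homeomorphism W W' F H" "smooth_on W' H" "smooth_on U F"
    "\<And>u. u \<in> U \<Longrightarrow> fst (F u) = snd (snd (f u))"
    "\<And>u v. u \<in> U \<Longrightarrow> fst (differential F u v) = dz u v"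
    "\<And>u. u \<in> U \<Longrightarrow> differential F u (e1_coords u) = (1, 0)"
proof -
  define g where "g u = inverse (fst (f u)) *\<^sub>R fst (snd (f u))" for u
  have sg: "smooth_on U g" unfolding g_def[abs_def]
    using fst_pos by (intro smooth_on_scaleR smooth_on_inverse smooth_on_fst smooth_on_snd smooth_f open_U) force+
  have dg: "differential g u v = inverse (fst (f u)) *\<^sub>R fst (snd (differential f u v))
      - (inverse (fst (f u)) * fst (differential f u v) * inverse (fst (f u))) *\<^sub>R fst (snd (f u))"
    if u: "u \<in> U" for u v
  proof -
    have df: "(f has_derivative differential f u) (at u)"
      by (rule smooth_on_has_derivative[OF smooth_f u])
    have "fst (f u) \<noteq> 0" using fst_pos[OF u] by simp
    then have "(g has_derivative (\<lambda>v. inverse (fst (f u)) *\<^sub>R fst (snd (differential f u v))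
        + (- (inverse (fst (f u)) * fst (differential f u v) * inverse (fst (f u)))) *\<^sub>R fst (snd (f u)))) (at u)"
      unfolding g_def[abs_def]
      by (intro has_derivative_scaleR Deriv.has_derivative_inverse has_derivative_fst has_derivative_snd df)
    then show ?thesis by (simp add: differential_eq)
  qed
  have dg_e1: "differential g u (e1_coords u) = 0" if "u \<in> U" for u
    using fst_pos[OF that] by (simp add: dg[OF that] df_e1[OF that] theta_eq)
  have kernel: "v = 0" if u: "u \<in> U" and "dz u v = 0" "differential g u v = 0" for u v
  proof -
    let ?c = "fst (differential f u v) * inverse (fst (f u))"
    have "inverse (fst (f u)) *\<^sub>R fst (snd (differential f u v)) = inverse (fst (f u)) *\<^sub>R (?c *\<^sub>R fst (snd (f u)))"
      using that(3) unfolding dg[OF u] by (simp add: mult.assoc)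
    then have "fst (snd (differential f u v)) = ?c *\<^sub>R fst (snd (f u))"
      by (rule scaleR_left_imp_eq[rotated]) (use fst_pos[OF u] in simp)
    moreover have "fst (differential f u v) = ?c * fst (f u)" using fst_pos[OF u] by simp
    ultimately have "\<exists>c. differential f u v = c *\<^sub>R \<theta> u"
      using that(2) by (intro exI[of _ ?c]) (simp add: prod_eq_iff theta_eq)
    then obtain c where D: "differential f u v = c *\<^sub>R \<theta> u" ..
    have "lorentz (differential f u v) (differential f u v) = 0"
      unfolding D by (simp add: lorentz.scaleR_left lorentz.scaleR_right theta_null[OF u])
    then show "v = 0" using df_pos[OF u] by force
  qed
  \<comment> \<open>The space \<open>K\<close> has dimension \<open>n - 1\<close>; its image under \<open>dg\<close> is what \<open>L\<close> has to preserve.\<close>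
  define K where "K = {v. dz p v = 0}"
  have lin_dz: "linear (dz p)"
    using linear_compose[OF linear_df[OF p] bounded_linear.linear[OF bounded_linear_height]] by (simp add: o_def)
  have lin_dg: "linear (differential g p)" by (rule linear_differential[OF sg p])
  have K: "K = {v. adjoint (dz p) 1 \<bullet> v = 0}" "adjoint (dz p) 1 \<noteq> 0"
    using adjoint_works[OF lin_dz, of _ 1] dz_e1[OF p] unfolding K_def
    by (auto simp: inner_commute)
  have subK: "subspace K" unfolding K(1) by (rule subspace_hyperplane)
  have injK: "inj_on (differential g p) K"
    using kernel[OF p] unfolding K_def linear_injective_on_subspace_0[OF lin_dg subK[unfolded K_def]] by blast
  have "dim (differential g p ` K) = dim K"
    by (rule dim_image_eq[OF lin_dg]) (unfold span_eq_iff[THEN iffD2, OF subK], rule injK)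
  also have "\<dots> = DIM(real^'n) - 1" unfolding K(1) by (rule dim_hyperplane[OF K(2)])
  also have "\<dots> = dim (UNIV :: (real^'k) set)" using k by simp
  finally obtain L where L: "linear L" "L ` (differential g p ` K) = (UNIV :: (real^'k) set)" "inj_on L (differential g p ` K)"
    using subspace_isomorphism[OF linear_subspace_image[OF lin_dg subK] subspace_UNIV] by blast
  have bL: "bounded_linear L" using L(1) linear_conv_bounded_linear by blast
  define F where "F u = (snd (snd (f u)), L (g u))" for u
  have sF: "smooth_on U F" unfolding F_def[abs_def]
    by (intro smooth_on_Pair smooth_on_snd smooth_f open_U smooth_on_bounded_linear[OF _ bL] sg)
  have dF: "differential F u v = (dz u v, L (differential g u v))" if u: "u \<in> U" for u v
  proof -
    have "(F has_derivative (\<lambda>v. (dz u v, L (differential g u v)))) (at u)"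
      unfolding F_def[abs_def]
      by (intro has_derivative_Pair has_derivative_snd bounded_linear.has_derivative[OF bL]
          smooth_on_has_derivative[OF smooth_f u] smooth_on_has_derivative[OF sg u])
    then show ?thesis by (simp add: differential_eq)
  qed
  have "inj (differential F p)"
    unfolding linear_injective_0[OF linear_differential[OF sF p]] dF[OF p]
  proof (intro allI impI)
    fix v assume v: "(dz p v, L (differential g p v)) = 0"
    then have "v \<in> K" by (simp add: K_def zero_prod_def)
    moreover have "0 \<in> K" using subK by (rule subspace_0)
    moreover have "L (differential g p v) = L (differential g p 0)"
      using v linear_0[OF L(1)] linear_0[OF lin_dg] by (simp add: zero_prod_def)
    ultimately show "v = 0" using L(3) injK by (meson imageI inj_onD)
  qed
  then obtain W W' H where "open W" "W \<subseteq> U" "p \<in> W" "open W'" "homeomorphism W W' F H" "smooth_on W' H"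
    using smooth_inverse_function[OF open_U sF p] k by (metis DIM_cart DIM_prod DIM_real mult_1_right add.commute)
  then show thesis
    using that[of W W' F H] sF dF linear_0[OF L(1)] by (simp add: F_def dz_e1 dg_e1)
qed

end

section \<open>Splitting off the last coordinate\<close>

lemma smooth_on_slice:
  assumes "smooth_on Q H" "open Q" "open S" "\<And>s. s \<in> S \<Longrightarrow> j s \<in> Q" "smooth_on S j"
  shows "smooth_on S (\<lambda>s. H (j s))"
  by (rule smooth_on_compose[OF assms(3,2) _ assms(1,5)]) (use assms(4) in auto)

context cylinder_patch
begin

text \<open>
  On a box in adapted coordinates, with \<open>H\<close> the inverse of \<open>F\<close>, the curve \<open>s \<mapsto> H (s, t)\<close> has velocity
  \<open>e\<^sub>1\<close>, so \<open>\<theta>\<close> and its first component grow at the same rate \<open>\<alpha>\<close>, which is independent of \<open>t\<close> by flatness.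
  The slice \<open>s = s\<^sub>0\<close> of \<open>\<theta>\<close>, rescaled, is the submanifold of the light cone.
\<close>

lemma flat_imp_local_product:
  assumes p: "p \<in> U" and k: "CARD('n) = CARD('k::finite) + 1"
    and flat: "\<And>u v w. u \<in> U \<Longrightarrow> normal_curvature f (\<lambda>_. v) (\<lambda>_. w) \<theta> u = 0"
  obtains W I V and F :: "real^'n \<Rightarrow> real \<times> (real^'k)" and H \<alpha>h \<gamma>
  where "open W" "W \<subseteq> U" "p \<in> W" "open I" "is_interval I" "open V"
    "homeomorphism W (I \<times> V) F H" "smooth_on (I \<times> V) H" "smooth_on W F"
    "smooth_on I \<alpha>h" "\<And>s. s \<in> I \<Longrightarrow> \<alpha>h s \<noteq> 0" "spacelike_immersion V \<gamma>" "\<gamma> ` V \<subseteq> light_cone"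
    "\<And>s t. s \<in> I \<Longrightarrow> t \<in> V \<Longrightarrow> f (H (s, t)) = (\<alpha>h s * fst (\<gamma> t), \<alpha>h s *\<^sub>R snd (\<gamma> t), s)"
proof -
  obtain W0 W' and F :: "real^'n \<Rightarrow> real \<times> (real^'k)" and H
    where W0: "open W0" "W0 \<subseteq> U" "p \<in> W0" and W': "open W'" and hom0: "homeomorphism W0 W' F H"
    and sH0: "smooth_on W' H" and sF: "smooth_on U F"
    and F1: "\<And>u. u \<in> U \<Longrightarrow> fst (F u) = snd (snd (f u))"
    and dF1: "\<And>u v. u \<in> U \<Longrightarrow> fst (differential F u v) = dz u v"
    and dF: "\<And>u. u \<in> U \<Longrightarrow> differential F u (e1_coords u) = (1, 0)"
    using adapted_coordinates[OF p k] by blast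
  obtain s0 t0 where st0: "F p = (s0, t0)" by fastforce
  have "F p \<in> W'" using hom0 W0(3) by (auto simp: homeomorphism_def)
  then obtain I0 V0 where IV0: "open I0" "open V0" "s0 \<in> I0" "t0 \<in> V0" "I0 \<times> V0 \<subseteq> W'"
    using open_prod_elim[OF W'] st0 by (metis mem_Sigma_iff)
  obtain \<epsilon> \<delta> where ed: "\<epsilon> > 0" "ball s0 \<epsilon> \<subseteq> I0" "\<delta> > 0" "ball t0 \<delta> \<subseteq> V0"
    using IV0 open_contains_ball by metis
  define I where "I = ball s0 \<epsilon>"
  define V where "V = ball t0 \<delta>"
  have oI: "open I" "convex I" "s0 \<in> I" and oV: "open V" "convex V" "t0 \<in> V"
    using ed by (auto simp: I_def V_def)
  have Q: "I \<times> V \<subseteq> W'" "open (I \<times> V)" using IV0 ed oI oV by (auto simp: I_def V_def intro: open_Times)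
  have sH: "smooth_on (I \<times> V) H" by (rule smooth_on_subset[OF sH0 Q(1)])
  define W where "W = W0 \<inter> F -` (I \<times> V)"
  have W: "open W" "W \<subseteq> U" "p \<in> W" "W \<subseteq> W0"
    using continuous_open_preimage[OF continuous_on_subset[OF smooth_on_continuous_on[OF sF] W0(2)] W0(1) Q(2)]
      W0 st0 oI oV unfolding W_def by auto
  have FW: "F ` W = I \<times> V"
  proof
    show "F ` W \<subseteq> I \<times> V" unfolding W_def by auto
    show "I \<times> V \<subseteq> F ` W"
    proof
      fix q assume "q \<in> I \<times> V"
      then have "q \<in> W'" using Q by blast
      then have "H q \<in> W0" "F (H q) = q" using hom0 by (auto simp: homeomorphism_def)
      then show "q \<in> F ` W" using \<open>q \<in> I \<times> V\<close> unfolding W_def by (metis Int_iff image_iff vimageI)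
    qed
  qed
  have hom: "homeomorphism W (I \<times> V) F H"
    by (rule homeomorphism_of_subsets[OF hom0 W(4) Q(1) FW])
  have HW: "H q \<in> W" "F (H q) = q" if "q \<in> I \<times> V" for q
    using hom that by (auto simp: homeomorphism_def)
  have HF: "H (F u) = u" if "u \<in> W" for u using hom that by (auto simp: homeomorphism_def)
  have HU: "H q \<in> U" if "q \<in> I \<times> V" for q using HW that W by blast
  have dH: "(H has_derivative differential H q) (at q)" if "q \<in> I \<times> V" for q
    by (rule smooth_on_has_derivative[OF sH that])
  have dFH: "differential F (H q) (differential H q w) = w" if q: "q \<in> I \<times> V" for q w
  proof -
    have "differential (\<lambda>q. F (H q)) q = differential (\<lambda>q. q) q"
      by (rule differential_cong[OF Q(2) q]) (rule HW)
    then show ?thesis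
      unfolding differential_compose[OF sF sH q HU[OF q]] frechet_derivative_ident by (rule fun_cong)
  qed
  have dHF: "differential H q (differential F (H q) v) = v" if q: "q \<in> I \<times> V" for q v
  proof -
    have "differential (\<lambda>u. H (F u)) (H q) = differential (\<lambda>u. u) (H q)"
      by (rule differential_cong[OF W(1) HW(1)[OF q]]) (rule HF)
    then show ?thesis
      unfolding differential_compose[OF sH sF HU[OF q], unfolded HW(2)[OF q], OF q] frechet_derivative_ident
      by (rule fun_cong)
  qed
  \<comment> \<open>The coordinate field of \<open>s\<close> is \<open>e\<^sub>1\<close>, and the slices \<open>s = const\<close> are level sets of \<open>z\<close>.\<close>
  have dH10: "differential H q (1, 0) = e1_coords (H q)" if "q \<in> I \<times> V" for q
    using dHF[OF that, of "e1_coords (H q)"] dF[OF HU[OF that]] by simp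
  have dz_t: "dz (H q) (differential H q (0, w)) = 0" if "q \<in> I \<times> V" for q w
    using dF1[OF HU[OF that], of "differential H q (0, w)"] dFH[OF that] by simp
  have deriv_s: "((\<lambda>s. H (s, t)) has_derivative (\<lambda>d. d *\<^sub>R e1_coords (H (s, t)))) (at s)"
    if "s \<in> I" "t \<in> V" for s t
  proof -
    have q: "(s, t) \<in> I \<times> V" using that by simp
    interpret linear "differential H (s, t)" using linear_differential[OF sH q] .
    have "((\<lambda>s. (s, t)) has_derivative (\<lambda>d. (d, 0))) (at s)"
      by (intro has_derivative_Pair has_derivative_ident has_derivative_const)
    from has_derivative_compose[OF this dH[OF q]]
    have "((\<lambda>s. H (s, t)) has_derivative (\<lambda>d. differential H (s, t) (d, 0))) (at s)" .
    moreover have "differential H (s, t) (d, 0) = d *\<^sub>R e1_coords (H (s, t))" for d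
      using scale[of d "(1, 0)"] dH10[OF q] by simp
    ultimately show ?thesis by simp
  qed
  have deriv_t: "((\<lambda>t. H (s, t)) has_derivative (\<lambda>w. differential H (s, t) (0, w))) (at t)"
    if "s \<in> I" "t \<in> V" for s t
  proof -
    have "((\<lambda>t. (s, t)) has_derivative (\<lambda>w. (0, w))) (at t)"
      by (intro has_derivative_Pair has_derivative_ident has_derivative_const)
    from has_derivative_compose[OF this dH] show ?thesis using that by simp
  qed
  have alpha_t: "alpha_coeff (H (s, t)) = alpha_coeff (H (s, t0))" if s: "s \<in> I" and t: "t \<in> V" for s t
  proof -
    have "((\<lambda>t. alpha_coeff (H (s, t))) has_derivative (\<lambda>w. 0)) (at t within V)" if t: "t \<in> V" for t
    proof -
      have q: "(s, t) \<in> I \<times> V" using s t by simp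
      have "((\<lambda>t. alpha_coeff (H (s, t))) has_derivative (\<lambda>w. differential alpha_coeff (H (s, t)) (differential H (s, t) (0, w)))) (at t)"
        by (rule has_derivative_compose[OF deriv_t[OF s t] smooth_on_has_derivative[OF smooth_alpha_coeff HU[OF q]]])
      then show ?thesis
        by (simp add: alpha_coeff_constant_on_slices[OF HU[OF q] flat[OF HU[OF q]] dz_t[OF q]] has_derivative_at_withinI)
    qed
    then have "\<exists>c. \<forall>t\<in>V. alpha_coeff (H (s, t)) = c" by (rule has_derivative_zero_constant[OF oV(2)])
    then show ?thesis using t oV(3) by auto
  qed
  define r where "r s = fst (f (H (s, t0)))" for s
  have r: "r s > 0" if "s \<in> I" for s unfolding r_def using fst_pos HU that oV by simp
  have \<theta>_s: "((\<lambda>s. \<theta> (H (s, t))) has_derivative (\<lambda>d. (d * alpha_coeff (H (s, t0))) *\<^sub>R \<theta> (H (s, t)))) (at s)"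
    if "s \<in> I" "t \<in> V" for s t
  proof -
    have q: "(s, t) \<in> I \<times> V" using that by simp
    interpret linear "differential f (H (s, t))" using linear_df[OF HU[OF q]] .
    have "theta (differential f (H (s, t)) (d *\<^sub>R e1_coords (H (s, t)))) = (d * alpha_coeff (H (s, t0))) *\<^sub>R \<theta> (H (s, t))" for d
      using theta_df_e1[OF HU[OF q]] alpha_t[OF that]
        linear_scale[OF bounded_linear.linear[OF bounded_linear_theta], of d "differential f (H (s, t)) (e1_coords (H (s, t)))"]
      by (simp add: scale)
    then show ?thesis
      using has_derivative_compose[OF deriv_s[OF that] theta_has_derivative[OF HU[OF q]]] by simp
  qed
  have r_s: "(r has_derivative (\<lambda>d. d * alpha_coeff (H (s, t0)) * r s)) (at s)" if "s \<in> I" for s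
    using bounded_linear.has_derivative[OF bounded_linear_fst \<theta>_s[OF that oV(3)]]
    unfolding r_def[abs_def] by (simp add: theta_eq)
  have const_s: "inverse (r s) *\<^sub>R \<theta> (H (s, t)) = inverse (r s0) *\<^sub>R \<theta> (H (s0, t))"
    if s: "s \<in> I" and t: "t \<in> V" for s t
  proof -
    have "((\<lambda>s. inverse (r s) *\<^sub>R \<theta> (H (s, t))) has_derivative (\<lambda>d. 0)) (at s within I)" if s: "s \<in> I" for s
    proof -
      have "r s \<noteq> 0" using r[OF s] by simp
      then have der: "((\<lambda>s. inverse (r s) *\<^sub>R \<theta> (H (s, t))) has_derivative
        (\<lambda>d. inverse (r s) *\<^sub>R ((d * alpha_coeff (H (s, t0))) *\<^sub>R \<theta> (H (s, t)))
          + (- (inverse (r s) * (d * alpha_coeff (H (s, t0)) * r s) * inverse (r s))) *\<^sub>R \<theta> (H (s, t)))) (at s)"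
        by (intro has_derivative_scaleR Deriv.has_derivative_inverse r_s[OF s] \<theta>_s[OF s t])
      have zero: "inverse (r s) *\<^sub>R ((d * alpha_coeff (H (s, t0))) *\<^sub>R \<theta> (H (s, t)))
          + (- (inverse (r s) * (d * alpha_coeff (H (s, t0)) * r s) * inverse (r s))) *\<^sub>R \<theta> (H (s, t)) = 0" for d
        using \<open>r s \<noteq> 0\<close> by simp
      show ?thesis using der unfolding zero by (rule has_derivative_at_withinI)
    qed
    then have "\<exists>c. \<forall>s\<in>I. inverse (r s) *\<^sub>R \<theta> (H (s, t)) = c"
      by (rule has_derivative_zero_constant[OF oI(2)])
    then show ?thesis using s oI(3) by auto
  qed
  define \<gamma> where "\<gamma> t = (let q = inverse (r s0) *\<^sub>R f (H (s0, t)) in (fst q, fst (snd q)))" for t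
  have \<gamma>: "\<gamma> t = (inverse (r s0) * fst (f (H (s0, t))), inverse (r s0) *\<^sub>R fst (snd (f (H (s0, t)))))" for t
    by (simp add: \<gamma>_def Let_def)
  have r0: "r s0 > 0" by (rule r[OF oI(3)])
  have smooth_j1: "smooth_on I (\<lambda>s. H (s, t0))"
    by (rule smooth_on_slice[OF sH Q(2) oI(1)]) (use oV oI in \<open>auto intro: smooth_on_Pair smooth_on_id smooth_on_const\<close>)
  have smooth_j2: "smooth_on V (\<lambda>t. H (s0, t))"
    by (rule smooth_on_slice[OF sH Q(2) oV(1)]) (use oV oI in \<open>auto intro: smooth_on_Pair smooth_on_id smooth_on_const\<close>)
  have sr: "smooth_on I r"
    unfolding r_def[abs_def]
    by (intro smooth_on_fst oI smooth_on_slice[OF smooth_f open_U oI(1) _ smooth_j1]) (use HU oV in auto)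
  have sfj: "smooth_on V (\<lambda>t. f (H (s0, t)))"
    by (rule smooth_on_slice[OF smooth_f open_U oV(1) _ smooth_j2]) (use HU oI in auto)
  have s\<gamma>: "smooth_on V \<gamma>"
    unfolding \<gamma>[abs_def]
    by (intro smooth_on_Pair smooth_on_mult smooth_on_scaleR smooth_on_fst smooth_on_snd smooth_on_const oV(1) sfj)
  have imm: "lorentz (differential \<gamma> t w) (differential \<gamma> t w) > 0" if t: "t \<in> V" and "w \<noteq> 0" for t w
  proof -
    have q: "(s0, t) \<in> I \<times> V" using t oI by simp
    let ?v = "differential H (s0, t) (0, w)"
    have df: "((\<lambda>t. f (H (s0, t))) has_derivative (\<lambda>w. differential f (H (s0, t)) (differential H (s0, t) (0, w)))) (at t)"
      by (rule has_derivative_compose[OF deriv_t[OF oI(3) t] smooth_on_has_derivative[OF smooth_f HU[OF q]]])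
    have "(\<gamma> has_derivative (\<lambda>w. (inverse (r s0) * fst (differential f (H (s0, t)) (differential H (s0, t) (0, w))),
        inverse (r s0) *\<^sub>R fst (snd (differential f (H (s0, t)) (differential H (s0, t) (0, w))))))) (at t)"
      unfolding \<gamma>[abs_def]
      by (intro has_derivative_Pair has_derivative_mult_right has_derivative_scaleR_right has_derivative_fst has_derivative_snd df)
    then have d: "differential \<gamma> t w = (inverse (r s0) * fst (differential f (H (s0, t)) ?v),
        inverse (r s0) *\<^sub>R fst (snd (differential f (H (s0, t)) ?v)))"
      by (simp add: differential_eq)
    have "?v \<noteq> 0"
      using dFH[OF q, of "(0, w)"] linear_0[OF linear_differential[OF sF HU[OF q]]] \<open>w \<noteq> 0\<close> by (metis prod.inject zero_prod_def)
    then have "lorentz (differential f (H (s0, t)) ?v) (differential f (H (s0, t)) ?v) > 0"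
      by (rule df_pos[OF HU[OF q]])
    moreover have "lorentz (differential \<gamma> t w) (differential \<gamma> t w)
        = inverse (r s0) * inverse (r s0) * lorentz (differential f (H (s0, t)) ?v) (differential f (H (s0, t)) ?v)"
      unfolding d using dz_t[OF q, of w]
      by (cases "differential f (H (s0, t)) ?v") (simp add: lorentz_def inner_prod_def algebra_simps)
    ultimately show ?thesis using r0 by simp
  qed
  have immersed: "spacelike_immersion V \<gamma>"
    unfolding spacelike_immersion_def
  proof (intro conjI ballI allI impI s\<gamma> imm)
    fix t assume t: "t \<in> V"
    show "inj (differential \<gamma> t)"
      unfolding linear_injective_0[OF linear_differential[OF s\<gamma> t]]
      using imm[OF t] by (metis less_irrefl lorentz.zero_left)
  qed
  have cone: "\<gamma> ` V \<subseteq> light_cone"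
  proof
    fix y assume "y \<in> \<gamma> ` V"
    then obtain t where t: "t \<in> V" "y = \<gamma> t" by blast
    have q: "H (s0, t) \<in> U" using HU t oI by simp
    have "lorentz (\<gamma> t) (\<gamma> t) = inverse (r s0) * inverse (r s0) * lorentz (\<theta> (H (s0, t))) (\<theta> (H (s0, t)))"
      unfolding \<gamma> by (simp add: lorentz_def theta_eq inner_prod_def algebra_simps)
    then show "y \<in> light_cone"
      using theta_null[OF q] fst_pos[OF q] r0 t by (simp add: light_cone_def \<gamma>)
  qed
  have product: "f (H (s, t)) = (r s * fst (\<gamma> t), r s *\<^sub>R snd (\<gamma> t), s)" if st: "s \<in> I" "t \<in> V" for s t
  proof -
    have q: "(s, t) \<in> I \<times> V" using st by simp
    have "\<theta> (H (s, t)) = r s *\<^sub>R (inverse (r s) *\<^sub>R \<theta> (H (s, t)))" using r[OF st(1)] by simp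
    also have "\<dots> = r s *\<^sub>R (inverse (r s0) *\<^sub>R \<theta> (H (s0, t)))" by (simp only: const_s[OF st])
    finally have "\<theta> (H (s, t)) = (r s * fst (\<gamma> t), r s *\<^sub>R snd (\<gamma> t), 0)"
      by (simp add: theta_eq \<gamma>)
    moreover have "snd (snd (f (H (s, t)))) = s" using F1[OF HU[OF q]] HW(2)[OF q] by simp
    ultimately show ?thesis by (simp add: theta_eq prod_eq_iff)
  qed
  show thesis
  proof (rule that[OF W(1,2,3) oI(1) _ oV(1) hom sH _ sr _ immersed cone product])
    show "is_interval I" using oI(2) by (simp add: is_interval_convex_1)
    show "smooth_on W F" by (rule smooth_on_subset[OF sF W(2)])
    show "r s \<noteq> 0" if "s \<in> I" for s using r[OF that] by simp
  qed
qed

end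

section \<open>Patches and changes of parameter\<close>

lemma patchD:
  assumes "patch T U x"
  shows "open U" "openin T (x ` U)" "homeomorphic_map (top_of_set U) (subtopology T (x ` U)) x"
  using assms by (simp_all add: patch_def)

lemma patch_open_preimage:
  assumes "patch T U x" "openin T S"
  shows "open {u \<in> U. x u \<in> S}"
proof -
  have "continuous_map (top_of_set U) T x"
    using homeomorphic_imp_continuous_map[OF patchD(3)[OF assms(1)]]
    by (simp add: continuous_map_in_subtopology)
  from openin_continuous_map_preimage[OF this assms(2)] have "openin (top_of_set U) {u \<in> U. x u \<in> S}"
    by simp
  then show ?thesis using openin_open_eq[OF patchD(1)[OF assms(1)]] by simp
qed

lemma patch_inj_on: "patch T U x \<Longrightarrow> inj_on x U"
  using homeomorphic_imp_injective_map[OF patchD(3)] by simp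

lemma patch_reparametrize:
  assumes "patch T U x" "open W" "W \<subseteq> U" "open Q" "homeomorphism W Q F H"
  shows "patch T Q (x \<circ> H)"
proof -
  note x = patchD(2,3)[OF assms(1)]
  have "openin (top_of_set U) W" using assms(2,3) by (simp add: openin_open_eq open_subset)
  then have "openin (subtopology T (x ` U)) (x ` W)"
    using homeomorphic_imp_open_map[OF x(2)] by (auto simp: open_map_def)
  then have o: "openin T (x ` W)" using x(1) openin_trans_full by blast
  have HQ: "H ` Q = W" using assms(5) by (simp add: homeomorphism_def)
  have "homeomorphic_map (subtopology (top_of_set U) W) (subtopology (subtopology T (x ` U)) (x ` W)) x"
    by (rule homeomorphic_map_subtopologies[OF x(2)])
      (use assms(3) openin_subset[OF x(1)] in auto)
  then have "homeomorphic_map (top_of_set W) (subtopology T (x ` W)) x"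
    using assms(3) by (simp add: subtopology_subtopology Int_absorb1 image_mono)
  moreover have "homeomorphic_map (top_of_set Q) (top_of_set W) H"
    using homeomorphism_symD[OF assms(5)]
    unfolding homeomorphic_map_maps homeomorphic_maps_def homeomorphism_def
    by (auto intro!: exI[of _ F])
  ultimately have "homeomorphic_map (top_of_set Q) (subtopology T (x ` W)) (x \<circ> H)"
    by (rule homeomorphic_map_compose[rotated])
  moreover have "(x \<circ> H) ` Q = x ` W" by (simp only: image_comp[symmetric] HQ)
  ultimately show ?thesis unfolding patch_def using assms(4) o by simp
qed

lemma smooth_manifold_patch:
  assumes "smooth_manifold T A" "(U, x) \<in> A"
  shows "patch T U x"
proof -
  have "\<forall>(U, x) \<in> A. patch T U x" using assms(1) by (simp add: smooth_manifold_def)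
  from bspec[OF this assms(2)] show ?thesis by simp
qed

lemma smooth_manifold_compatible:
  assumes "smooth_manifold T A" "(U, x) \<in> A" "(V, y) \<in> A"
  shows "compatible U x V y"
proof -
  have "\<forall>(U, x) \<in> A. \<forall>(V, y) \<in> A. compatible U x V y" using assms(1) by (simp add: smooth_manifold_def)
  from bspec[OF this assms(2)] have "\<forall>(V, y) \<in> A. compatible U x V y" by simp
  from bspec[OF this assms(3)] show ?thesis by simp
qed

text \<open>
  The transition maps between the new patch and a patch of the atlas are those of \<open>x\<close> composed with
  \<open>F\<close> or with \<open>H\<close>, hence smooth.
\<close>

lemma parametrization_reparametrize:
  fixes x :: "'a::euclidean_space \<Rightarrow> 'm" and H :: "'b::euclidean_space \<Rightarrow> 'a"
  assumes man: "smooth_manifold T A" and xA: "(U, x) \<in> A"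
    and W: "open W" "W \<subseteq> U" and Q: "open Q" and hom: "homeomorphism W Q F H"
    and sH: "smooth_on Q H" and sF: "smooth_on W F"
  shows "parametrization T A Q (x \<circ> H)"
  unfolding parametrization_def
proof (intro conjI)
  have px: "patch T U x" by (rule smooth_manifold_patch[OF man xA])
  show py: "patch T Q (x \<circ> H)" by (rule patch_reparametrize[OF px W Q hom])
  have HW: "H q \<in> W" "F (H q) = q" if "q \<in> Q" for q
    using hom that by (auto simp: homeomorphism_def)
  have FQ: "F w \<in> Q" "H (F w) = w" if "w \<in> W" for w
    using hom that by (auto simp: homeomorphism_def)
  have img: "(x \<circ> H) ` Q = x ` W" using HW FQ by (force simp: image_iff)
  show "\<forall>(U', x') \<in> A. compatible U' x' Q (x \<circ> H)"
  proof (rule ballI)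
    fix c assume "c \<in> A"
    then obtain U' x' where c: "c = (U', x')" and xA': "(U', x') \<in> A" by (cases c) auto
    have px': "patch T U' x'" by (rule smooth_manifold_patch[OF man xA'])
    have "compatible U' x' U x" by (rule smooth_manifold_compatible[OF man xA' xA])
    then have c1: "smooth_on {u \<in> U'. x' u \<in> x ` U} (inv_into U x \<circ> x')"
      and c2: "smooth_on {v \<in> U. x v \<in> x' ` U'} (inv_into U' x' \<circ> x)"
      by (auto simp: compatible_def)
    define S where "S = {u \<in> U'. x' u \<in> x ` W}"
    have oS: "open S"
      unfolding S_def using patch_open_preimage[OF px' patchD(2)[OF py, unfolded img]] .
    have inv: "inv_into U x (x w) = w" if "w \<in> W" for w
      using patch_inj_on[OF px] W(2) that by auto
    have inv': "inv_into Q (x \<circ> H) (x w) = F w" if "w \<in> W" for w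
      using inv_into_f_f[OF patch_inj_on[OF py] FQ(1)[OF that]] FQ(2)[OF that] by simp
    have sS: "smooth_on S (\<lambda>u. F ((inv_into U x \<circ> x') u))"
    proof (rule smooth_on_compose[OF oS W(1) _ sF])
      show "smooth_on S (inv_into U x \<circ> x')"
        by (rule smooth_on_subset[OF c1]) (use W(2) in \<open>auto simp: S_def\<close>)
      show "(inv_into U x \<circ> x') ` S \<subseteq> W" using inv by (auto simp: S_def)
    qed
    have 1: "smooth_on S (inv_into Q (x \<circ> H) \<circ> x')"
    proof (rule smooth_on_cong[OF oS _ sS])
      fix u assume "u \<in> S"
      then obtain w where "w \<in> W" "x' u = x w" by (auto simp: S_def)
      then show "F ((inv_into U x \<circ> x') u) = (inv_into Q (x \<circ> H) \<circ> x') u"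
        by (simp add: inv inv')
    qed
    define R where "R = {v \<in> U. x v \<in> x' ` U'}"
    have oR: "open R" unfolding R_def by (rule patch_open_preimage[OF px patchD(2)[OF px']])
    define S' where "S' = {q \<in> Q. (x \<circ> H) q \<in> x' ` U'}"
    have oS': "open S'" unfolding S'_def by (rule patch_open_preimage[OF py patchD(2)[OF px']])
    have "smooth_on S' (\<lambda>q. (inv_into U' x' \<circ> x) (H q))"
    proof (rule smooth_on_compose[where f="inv_into U' x' \<circ> x" and g=H, OF oS' oR])
      show "H ` S' \<subseteq> R" using HW W(2) by (auto simp: S'_def R_def)
      show "smooth_on R (inv_into U' x' \<circ> x)" unfolding R_def by (rule c2)
      show "smooth_on S' H" by (rule smooth_on_subset[OF sH]) (auto simp: S'_def)
    qed
    then have 2: "smooth_on S' (inv_into U' x' \<circ> (x \<circ> H))" by (simp add: o_def)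
    have "compatible U' x' Q (x \<circ> H)"
      unfolding compatible_def img using 1 2 unfolding S_def S'_def by simp
    then show "case c of (U', x') \<Rightarrow> compatible U' x' Q (x \<circ> H)" unfolding c by simp
  qed
qed

lemma second_countable_euclidean:
  "second_countable (euclidean :: 'a::second_countable_topology topology)"
proof -
  obtain B :: "'a set set" where B: "countable B" "topological_basis B"
    using ex_countable_basis by blast
  have "\<exists>S\<in>B. x \<in> S \<and> S \<subseteq> O'" if "open O'" "x \<in> O'" for O' and x :: 'a
    using topological_basisE[OF B(2) that] by metis
  then show ?thesis
    unfolding second_countable_def using B topological_basis_open[OF B(2)]
    by (intro exI[of _ B]) simp
qed

lemma riemannian_submanifold_open_set:
  fixes V :: "'a::euclidean_space set"
  assumes "open V" "spacelike_immersion V \<gamma>"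
  shows "riemannian_submanifold (top_of_set V) {(V, id)} \<gamma>"
proof -
  have "patch (top_of_set V) V (id :: 'a \<Rightarrow> 'a)"
    unfolding patch_def using assms(1) by (simp add: subtopology_subtopology)
  moreover have "smooth_on V (inv_into V id \<circ> (id :: 'a \<Rightarrow> 'a))"
    by (rule smooth_on_cong[OF assms(1) _ smooth_on_id[OF assms(1)]]) (metis comp_id id_apply inj_on_id inv_into_f_f)
  then have "compatible V (id :: 'a \<Rightarrow> 'a) V id" unfolding compatible_def by simp
  ultimately show ?thesis
    using assms(2)
    by (simp add: riemannian_submanifold_def smooth_manifold_def Hausdorff_space_subtopology
        second_countable_subtopology second_countable_euclidean)
qed

section \<open>Local products and flatness\<close>

text \<open>
  In the given patch \<open>x\<close>, with transition maps \<open>\<tau>\<close> and \<open>\<sigma>\<close> to and from the product parameters, \<open>\<gamma>\<close> pulled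
  back by \<open>\<tau>\<close> is a parallel null normal field: along the slice \<open>s = const\<close> the position vector is
  \<open>\<alpha>h s\<close> times it up to a constant, so its derivatives are tangent.
\<close>

lemma local_product_imp_flat:
  fixes x :: "real^'n \<Rightarrow> 'm" and y :: "real \<times> (real^'k) \<Rightarrow> 'm"
    and \<phi> :: "'m \<Rightarrow> real \<times> (real^'n) \<times> real"
  assumes px: "patch T U x" and imm: "spacelike_immersion U (\<phi> \<circ> x)"
    and cyl: "(\<phi> \<circ> x) ` U \<subseteq> light_cone_cylinder"
    and py: "patch T (I \<times> V) y" and comp: "compatible U x (I \<times> V) y"
    and oV: "open V" and \<gamma>: "smooth_on V \<gamma>" "\<gamma> ` V \<subseteq> light_cone"
    and \<alpha>h: "\<And>s. s \<in> I \<Longrightarrow> \<alpha>h s \<noteq> 0"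
    and prod: "\<And>s t. s \<in> I \<Longrightarrow> t \<in> V \<Longrightarrow> \<phi> (y (s, t)) = (\<alpha>h s * fst (\<gamma> t), \<alpha>h s *\<^sub>R snd (\<gamma> t), s)"
    and u: "u \<in> U" "x u \<in> y ` (I \<times> V)"
    and XY: "smooth_on U X" "smooth_on U Y" and \<xi>: "normal_field (\<phi> \<circ> x) U \<xi>"
  shows "normal_curvature (\<phi> \<circ> x) X Y \<xi> u = 0"
proof -
  define f where "f = \<phi> \<circ> x"
  define W where "W = {u \<in> U. x u \<in> y ` (I \<times> V)}"
  define W' where "W' = {q \<in> I \<times> V. y q \<in> x ` U}"
  define \<tau> where "\<tau> = inv_into (I \<times> V) y \<circ> x"
  define \<sigma> where "\<sigma> = inv_into U x \<circ> y"
  have oW: "open W" unfolding W_def by (rule patch_open_preimage[OF px patchD(2)[OF py]])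
  have oW': "open W'" unfolding W'_def by (rule patch_open_preimage[OF py patchD(2)[OF px]])
  have s\<tau>: "smooth_on W \<tau>" and s\<sigma>: "smooth_on W' \<sigma>"
    using comp by (simp_all add: compatible_def W_def W'_def \<tau>_def \<sigma>_def)
  have WU: "W \<subseteq> U" by (auto simp: W_def)
  have \<tau>: "\<tau> u \<in> I \<times> V" "y (\<tau> u) = x u" if "u \<in> W" for u
    using that unfolding W_def \<tau>_def by (simp_all add: inv_into_into f_inv_into_f)
  have \<tau>W: "\<tau> u \<in> W'" "\<sigma> (\<tau> u) = u" if "u \<in> W" for u
    using \<tau>[OF that] that WU patch_inj_on[OF px] unfolding W'_def \<sigma>_def by auto
  have \<sigma>: "\<sigma> q \<in> U" "x (\<sigma> q) = y q" if "q \<in> W'" for q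
    using that unfolding W'_def \<sigma>_def by (simp_all add: inv_into_into f_inv_into_f)
  have f_eq: "f u = (\<alpha>h (fst (\<tau> u)) * fst (\<gamma> (snd (\<tau> u))), \<alpha>h (fst (\<tau> u)) *\<^sub>R snd (\<gamma> (snd (\<tau> u))), fst (\<tau> u))"
    if "u \<in> W" for u
    using prod[of "fst (\<tau> u)" "snd (\<tau> u)"] \<tau>[OF that] by (auto simp: f_def mem_Times_iff)
  interpret spacelike_patch W f
    using oW imm WU smooth_on_subset unfolding f_def[symmetric]
    by unfold_locales (auto simp: spacelike_immersion_def)
  interpret cylinder_patch W f
    using cyl WU by unfold_locales (auto simp: f_def)
  define \<iota> where "\<iota> p = (fst p, snd p, 0 :: real)" for p :: "real \<times> (real^'n)"
  have b\<iota>: "bounded_linear \<iota>" unfolding \<iota>_def[abs_def]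
    by (intro bounded_linear_Pair bounded_linear_fst bounded_linear_snd bounded_linear_zero)
  define \<zeta> where "\<zeta> u = \<iota> (\<gamma> (snd (\<tau> u)))" for u
  have t: "snd (\<tau> u) \<in> V" "fst (\<tau> u) \<in> I" if "u \<in> W" for u
    using \<tau>(1)[OF that] by (auto simp: mem_Times_iff)
  have s\<zeta>: "smooth_on W \<zeta>" unfolding \<zeta>_def[abs_def]
    by (rule smooth_on_bounded_linear[OF oW b\<iota> smooth_on_compose[OF oW oV _ \<gamma>(1) smooth_on_snd[OF oW s\<tau>]]])
      (use t in auto)
  have \<theta>\<zeta>: "\<theta> u = \<alpha>h (fst (\<tau> u)) *\<^sub>R \<zeta> u" if "u \<in> W" for u
    by (simp add: theta_eq f_eq[OF that] \<zeta>_def \<iota>_def)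
  have \<zeta>n: "\<zeta> u \<in> normal_space f u" if "u \<in> W" for u
    using normal_space_scaleR[OF theta_normal[OF that], of "inverse (\<alpha>h (fst (\<tau> u)))"] \<alpha>h[OF t(2)[OF that]]
    unfolding \<theta>\<zeta>[OF that] by simp
  have cone: "lorentz (\<zeta> u) (\<zeta> u) = 0" "fst (\<zeta> u) \<noteq> 0" if "u \<in> W" for u
    using \<gamma>(2) t(1)[OF that] by (force simp: \<zeta>_def \<iota>_def light_cone_def lorentz_def)+
  have par: "differential \<zeta> u v \<in> tangent_space f u" if uW: "u \<in> W" for u v
  proof -
    obtain s t where st: "\<tau> u = (s, t)" by fastforce
    define w where "w = snd (differential \<tau> u v)"
    have sI: "s \<in> I" and tV: "t \<in> V" using \<tau>(1)[OF uW] st by auto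
    have q: "(s, t) \<in> W'" and \<sigma>u: "\<sigma> (s, t) = u" using \<tau>W[OF uW] st by auto
    have d\<gamma>: "((\<lambda>t. \<iota> (\<gamma> t)) has_derivative (\<lambda>w. \<iota> (differential \<gamma> t w))) (at t)"
      by (rule bounded_linear.has_derivative[OF b\<iota> smooth_on_has_derivative[OF \<gamma>(1) tV]])
    have d\<zeta>: "differential \<zeta> u v = \<iota> (differential \<gamma> t w)"
    proof -
      have "((\<lambda>u. snd (\<tau> u)) has_derivative (\<lambda>v. snd (differential \<tau> u v))) (at u)"
        by (rule has_derivative_snd[OF smooth_on_has_derivative[OF s\<tau> uW]])
      moreover have "snd (\<tau> u) = t" using st by simp
      ultimately have "(\<zeta> has_derivative (\<lambda>v. \<iota> (differential \<gamma> t (snd (differential \<tau> u v))))) (at u)"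
        unfolding \<zeta>_def[abs_def] using has_derivative_compose[of "\<lambda>u. snd (\<tau> u)"] d\<gamma> by blast
      then show ?thesis by (simp add: differential_eq w_def)
    qed
    have slice: "open {t'. (s, t') \<in> W'}"
      using open_vimage[OF oW', of "\<lambda>t'. (s, t')"] by (simp add: vimage_def continuous_on_Pair)
    have "((\<lambda>t'. (s, t')) has_derivative (\<lambda>w. (0, w))) (at t)"
      by (intro has_derivative_Pair has_derivative_ident has_derivative_const)
    from has_derivative_compose[OF this smooth_on_has_derivative[OF s\<sigma> q]]
    have d\<sigma>: "((\<lambda>t'. \<sigma> (s, t')) has_derivative (\<lambda>w. differential \<sigma> (s, t) (0, w))) (at t)" .
    have A: "((\<lambda>t'. f (\<sigma> (s, t'))) has_derivative (\<lambda>w. differential f u (differential \<sigma> (s, t) (0, w)))) (at t)"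
      using has_derivative_compose[OF d\<sigma>, of f "differential f u"]
        smooth_on_has_derivative[OF smooth_f uW] unfolding \<sigma>u by simp
    have eq: "f (\<sigma> (s, t')) = \<alpha>h s *\<^sub>R \<iota> (\<gamma> t') + (0, 0, s)" if "t' \<in> {t'. (s, t') \<in> W'}" for t'
      using \<sigma>[of "(s, t')"] that prod[of s t'] by (simp add: f_def \<iota>_def W'_def)
    have B: "((\<lambda>t'. \<alpha>h s *\<^sub>R \<iota> (\<gamma> t') + (0, 0, s)) has_derivative (\<lambda>w. \<alpha>h s *\<^sub>R \<iota> (differential \<gamma> t w) + 0)) (at t)"
      by (intro has_derivative_add has_derivative_scaleR_right d\<gamma> has_derivative_const)
    have "((\<lambda>t'. f (\<sigma> (s, t'))) has_derivative (\<lambda>w. \<alpha>h s *\<^sub>R \<iota> (differential \<gamma> t w) + 0)) (at t)"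
      by (rule has_derivative_transform_within_open[OF B slice]) (use q eq in auto)
    then have "differential f u (differential \<sigma> (s, t) (0, w)) = \<alpha>h s *\<^sub>R \<iota> (differential \<gamma> t w)"
      using fun_cong[OF has_derivative_unique[OF A], of _ w] by simp
    then have "differential \<zeta> u v = differential f u (inverse (\<alpha>h s) *\<^sub>R differential \<sigma> (s, t) (0, w))"
      using \<alpha>h[OF sI] by (simp add: linear_scale[OF linear_df[OF uW]] d\<zeta>)
    then show ?thesis by (simp add: tangent_space_def)
  qed
  have \<xi>W: "normal_field f W \<xi>"
    using \<xi> WU smooth_on_subset unfolding f_def normal_field_def by blast
  have uW: "u \<in> W" using u by (simp add: W_def)
  have "normal_curvature f X Y \<xi> u = 0"
    by (rule flat_if_parallel_null_field[OF _ s\<zeta> \<zeta>n cone par smooth_on_subset[OF XY(1) WU]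
          smooth_on_subset[OF XY(2) WU] \<xi>W uW]) simp_all
  then show ?thesis unfolding f_def .
qed

theorem proposition4p2:
  fixes T :: "'m topology"
    and A :: "((real ^ 'n) set \<times> (real ^ 'n \<Rightarrow> 'm)) set"
    and \<phi> :: "'m \<Rightarrow> real \<times> (real ^ 'n) \<times> real"
  assumes "CARD('n) \<ge> 2"
    and "CARD('n) = CARD('k::finite) + 1"
    and "riemannian_submanifold T A \<phi>"
    and "\<phi> ` topspace T \<subseteq> light_cone_cylinder"
    and "\<forall>(U, x) \<in> A. \<forall>u\<in>U. alpha (\<phi> \<circ> x) u \<noteq> 0"
  shows "flat_normal_bundle A \<phi> \<longleftrightarrow>
    (\<forall>p \<in> topspace T.
      \<exists>(I :: real set) (V :: (real ^ 'k) set) (y :: real \<times> (real ^ 'k) \<Rightarrow> 'm)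
        (\<alpha>h :: real \<Rightarrow> real) (\<gamma> :: real ^ 'k \<Rightarrow> real \<times> (real ^ 'n)).
        open I \<and> is_interval I \<and> smooth_on I \<alpha>h \<and> (\<forall>s\<in>I. \<alpha>h s \<noteq> 0) \<and>
        riemannian_submanifold (top_of_set V) {(V, id)} \<gamma> \<and> \<gamma> ` V \<subseteq> light_cone \<and>
        parametrization T A (I \<times> V) y \<and> p \<in> y ` (I \<times> V) \<and>
        (\<forall>s\<in>I. \<forall>t\<in>V. \<phi> (y (s, t)) = (\<alpha>h s * fst (\<gamma> t), \<alpha>h s *\<^sub>R snd (\<gamma> t), s)))"
    (is "?flat \<longleftrightarrow> ?local")
proof
  have man: "smooth_manifold T A" using assms(3) by (simp add: riemannian_submanifold_def)
  have imm: "spacelike_immersion U (\<phi> \<circ> x)" if "(U, x) \<in> A" for U x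
  proof -
    have "\<forall>(U, x) \<in> A. spacelike_immersion U (\<phi> \<circ> x)" using assms(3) by (simp add: riemannian_submanifold_def)
    from bspec[OF this that] show ?thesis by simp
  qed
  have cyl: "(\<phi> \<circ> x) ` U \<subseteq> light_cone_cylinder" if "(U, x) \<in> A" for U x
    using openin_subset[OF patchD(2)[OF smooth_manifold_patch[OF man that]]] assms(4) by auto
  have cyl_patch: "cylinder_patch U (\<phi> \<circ> x)" if "(U, x) \<in> A" for U x
    using patchD(1)[OF smooth_manifold_patch[OF man that]] imm[OF that] cyl[OF that]
    by unfold_locales
  {
    assume flat: ?flat
    show ?local
    proof
      fix p assume "p \<in> topspace T"
      then have "p \<in> (\<Union>(U, x) \<in> A. x ` U)" using man by (simp add: smooth_manifold_def)
      then obtain U x u where A: "(U, x) \<in> A" and u: "u \<in> U" "p = x u" by auto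
      interpret cylinder_patch U "\<phi> \<circ> x" by (rule cyl_patch[OF A])
      have flatU: "\<forall>X Y \<xi>. smooth_on U X \<longrightarrow> smooth_on U Y \<longrightarrow> normal_field (\<phi> \<circ> x) U \<xi> \<longrightarrow>
          (\<forall>u\<in>U. normal_curvature (\<phi> \<circ> x) X Y \<xi> u = 0)"
        using bspec[OF flat[unfolded flat_normal_bundle_def] A] by simp
      have "normal_field (\<phi> \<circ> x) U \<theta>" using smooth_theta theta_normal by (simp add: normal_field_def)
      then have flat_\<theta>: "normal_curvature (\<phi> \<circ> x) (\<lambda>_. v) (\<lambda>_. w) \<theta> u = 0" if "u \<in> U" for u v w
        using flatU smooth_on_const[OF open_U] that by blast
      show "\<exists>(I :: real set) (V :: (real ^ 'k) set) (y :: real \<times> (real ^ 'k) \<Rightarrow> 'm)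
        (\<alpha>h :: real \<Rightarrow> real) (\<gamma> :: real ^ 'k \<Rightarrow> real \<times> (real ^ 'n)).
        open I \<and> is_interval I \<and> smooth_on I \<alpha>h \<and> (\<forall>s\<in>I. \<alpha>h s \<noteq> 0) \<and>
        riemannian_submanifold (top_of_set V) {(V, id)} \<gamma> \<and> \<gamma> ` V \<subseteq> light_cone \<and>
        parametrization T A (I \<times> V) y \<and> p \<in> y ` (I \<times> V) \<and>
        (\<forall>s\<in>I. \<forall>t\<in>V. \<phi> (y (s, t)) = (\<alpha>h s * fst (\<gamma> t), \<alpha>h s *\<^sub>R snd (\<gamma> t), s))"
      proof (rule flat_imp_local_product[OF u(1) assms(2) flat_\<theta>])
        fix W and I :: "real set" and V :: "(real ^ 'k) set" and F :: "real ^ 'n \<Rightarrow> real \<times> (real ^ 'k)"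
          and H :: "real \<times> (real ^ 'k) \<Rightarrow> real ^ 'n" and \<alpha>h :: "real \<Rightarrow> real"
          and \<gamma> :: "real ^ 'k \<Rightarrow> real \<times> (real ^ 'n)"
        assume W: "open W" "W \<subseteq> U" "u \<in> W" and I: "open I" "is_interval I" and V: "open V"
          and hom: "homeomorphism W (I \<times> V) F H" and sH: "smooth_on (I \<times> V) H" and sF: "smooth_on W F"
          and \<alpha>h: "smooth_on I \<alpha>h" "\<And>s. s \<in> I \<Longrightarrow> \<alpha>h s \<noteq> 0"
          and \<gamma>: "spacelike_immersion V \<gamma>" "\<gamma> ` V \<subseteq> light_cone"
          and prod: "\<And>s t. s \<in> I \<Longrightarrow> t \<in> V \<Longrightarrow>
            (\<phi> \<circ> x) (H (s, t)) = (\<alpha>h s * fst (\<gamma> t), \<alpha>h s *\<^sub>R snd (\<gamma> t), s)"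
        have "p \<in> (x \<circ> H) ` (I \<times> V)"
          using hom W(3) u(2) by (force simp: homeomorphism_def image_iff)
        then show ?thesis
          using I \<alpha>h \<gamma>(2) riemannian_submanifold_open_set[OF V \<gamma>(1)] prod
            parametrization_reparametrize[OF man A W(1,2) open_Times[OF I(1) V] hom sH sF]
          by (intro exI[of _ I] exI[of _ V] exI[of _ "x \<circ> H"] exI[of _ \<alpha>h] exI[of _ \<gamma>]) simp
      qed
    qed
  }
  {
    assume local: ?local
    show ?flat
      unfolding flat_normal_bundle_def
    proof clarify
      fix U :: "(real ^ 'n) set" and x X Y \<xi> and u :: "real ^ 'n"
      assume A: "(U, x) \<in> A" and XY: "smooth_on U (X :: real ^ 'n \<Rightarrow> real ^ 'n)" "smooth_on U (Y :: real ^ 'n \<Rightarrow> real ^ 'n)"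
        and \<xi>: "normal_field (\<phi> \<circ> x) U \<xi>" and u: "u \<in> U"
      have px: "patch T U x" by (rule smooth_manifold_patch[OF man A])
      have "x u \<in> topspace T" using openin_subset[OF patchD(2)[OF px]] u by auto
      from bspec[OF local this] show "normal_curvature (\<phi> \<circ> x) X Y \<xi> u = 0"
      proof (elim exE conjE)
        fix I :: "real set" and V :: "(real ^ 'k) set" and y :: "real \<times> (real ^ 'k) \<Rightarrow> 'm"
          and \<alpha>h :: "real \<Rightarrow> real" and \<gamma> :: "real ^ 'k \<Rightarrow> real \<times> (real ^ 'n)"
        assume \<alpha>h: "\<forall>s\<in>I. \<alpha>h s \<noteq> 0"
          and \<gamma>: "riemannian_submanifold (top_of_set V) {(V, id)} \<gamma>" "\<gamma> ` V \<subseteq> light_cone"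
          and y: "parametrization T A (I \<times> V) y" "x u \<in> y ` (I \<times> V)"
          and prod: "\<forall>s\<in>I. \<forall>t\<in>V. \<phi> (y (s, t)) = (\<alpha>h s * fst (\<gamma> t), \<alpha>h s *\<^sub>R snd (\<gamma> t), s)"
        have V: "open V" "smooth_on V \<gamma>"
          using \<gamma>(1) by (simp_all add: riemannian_submanifold_def smooth_manifold_def patch_def spacelike_immersion_def)
        have py: "patch T (I \<times> V) y" using y(1) by (simp add: parametrization_def)
        have "\<forall>(U, x) \<in> A. compatible U x (I \<times> V) y" using y(1) by (simp add: parametrization_def)
        from bspec[OF this A] have "compatible U x (I \<times> V) y" by simp
        from local_product_imp_flat[OF px imm[OF A] cyl[OF A] py this V \<gamma>(2) bspec[OF \<alpha>h] bspec[OF bspec[OF prod]] u y(2) XY \<xi>]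
        show "normal_curvature (\<phi> \<circ> x) X Y \<xi> u = 0" .
      qed
    qed
  }
qed

end
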